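(* Let $P=(P_A)_{A\in\mathcal{B}}$ be a neutral to the right random probability measure on $\mathcal{X}$ and let $\underline{X}=(X_1,\ldots,X_n)$ be a sample from $P$. Then the conditional distribution of $P$ given $\underline{X}=\underline{x}$ is also neutral to the right; that is, for all $B_1\subseteq B_2$ in $\mathcal{A}(u)$, $V_{B_1B_2}$ is conditionally independent of $\mathcal{F}_{B_1}$ given $\underline{X}$.
   Context: Setting. $\mathcal{X}$ is a Hausdorff topological space with Borel $\sigma$-field $\mathcal{B}$. There is a fixed collection $\mathcal{A}$ of closed subsets of $\mathcal{X}$ (an indexing collection) with $\sigma(\mathcal{A})=\mathcal{B}$ such that: (1) $\emptyset,\mathcal{X}\in\mathcal{A}$; (2) $\mathcal{A}$ is closed under arbitrary intersections; (3) if $A,B\in\mathcal{A}$ are nonempty then $A\cap B\ne\emptyset$; (4) there is a sequence $(\mathcal{A}_n)_n$ of finite sub-semilattices of $\mathcal{A}$ (finite subcollections closed under intersection) such that for every $A\in\mathcal{A}$ there exist $A_n\in\mathcal{A}_n(u)$ with $A=\bigcap_nA_n$ and $A\subseteq A_n^0$ (the interior of $A_n$) for all $n$, where $\mathcal{A}_n(u)$ is the class of finite unions of sets of $\mathcal{A}_n$. $\mathcal{A}(u)$ denotes the class of all finite unions of sets in $\mathcal{A}$. Random probability measure. A collection $P=(P_A)_{A\in\mathcal{B}}$ of $[0,1]$-valued random variables on a probability space $(\Omega,\mathcal{F},\mathcal{P})$ such that: (i) it is finitely additive in distribution: for pairwise disjoint $A_1,\ldots,A_k\in\mathcal{B}$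 and $1\le i_1<\cdots<i_m\le k$, with $i_0=0$, $i_{m+1}=k$, the vectors $(P_{\bigcup_{j=i_l+1}^{i_{l+1}}A_j})_{l=0,\ldots,m}$ and $(\sum_{j=i_l+1}^{i_{l+1}}P_{A_j})_{l=0,\ldots,m}$ have the same distribution; (ii) $P_{\mathcal{X}}=1$ a.s.; (iii) for every decreasing sequence $(A_n)_n\subseteq\mathcal{B}$ with $\bigcap_nA_n=\emptyset$, $\lim_nP_{A_n}=0$ a.s. For $B_1\subseteq B_2$ in $\mathcal{A}(u)$, $V_{B_1B_2}:=(P_{B_2}-P_{B_1})/(1-P_{B_1})$ on $\{P_{B_1}<1\}$ and $V_{B_1B_2}:=1$ elsewhere. $P$ is called neutral to the right if for all $B_1\subseteq\cdots\subseteq B_k$ in $\mathcal{A}(u)$ the random variables $P_{B_1},V_{B_1B_2},\ldots,V_{B_{k-1}B_k}$ are independent. $\mathcal{F}_{B_1}:=\sigma(\{P_A:A\in\mathcal{A},A\subseteq B_1\})$. Sample. $\underline{X}=(X_1,\ldots,X_n)$ is a sample from $P$ if $X_1,\dots,X_n:\Omega\to\mathcal{X}$ are measurable and $\mathcal{P}[X_1\in A_1,\ldots,X_n\in A_n\mid P]=\prod_{i=1}^nP_{A_i}$ a.s. for all $A_1,\ldots,A_n\in\mathcal{B}$. The conditional distribution of $P$ given $\underline{X}=\underline{x}$ is called neutral to the right if for all $B_1\subseteq B_2$ in $\mathcal{A}(u)$, $V_{B_1B_2}$ is conditionally independent of $\mathcal{F}_{B_1}$ given $\underline{X}$. *)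

theory Defs
  imports "HOL-Probability.Probability"
begin

text \<open>The space \<open>\<X>\<close> is a type \<open>'x::t2_space\<close> and its Borel \<open>\<sigma>\<close>-field is \<^term>\<open>sets borel\<close>.\<close>

definition finite_unions :: "'x set set \<Rightarrow> 'x set set" where
  "finite_unions \<A> = {\<Union>\<S> |\<S>. finite \<S> \<and> \<S> \<subseteq> \<A>}"

definition finite_subsemilattice :: "'x set set \<Rightarrow> 'x set set \<Rightarrow> bool" where
  "finite_subsemilattice \<A>' \<A> \<longleftrightarrow> finite \<A>' \<and> \<A>' \<subseteq> \<A> \<and> (\<forall>A\<in>\<A>'. \<forall>B\<in>\<A>'. A \<inter> B \<in> \<A>')"

definition indexing_collection :: "'x::t2_space set set \<Rightarrow> bool" where
  "indexing_collection \<A> \<longleftrightarrow>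
     (\<forall>A\<in>\<A>. closed A) \<and>
     sigma_sets UNIV \<A> = sets borel \<and>
     {} \<in> \<A> \<and> UNIV \<in> \<A> \<and>
     (\<forall>\<S>. \<S> \<subseteq> \<A> \<longrightarrow> \<Inter>\<S> \<in> \<A>) \<and>
     (\<forall>A\<in>\<A>. \<forall>B\<in>\<A>. A \<noteq> {} \<longrightarrow> B \<noteq> {} \<longrightarrow> A \<inter> B \<noteq> {}) \<and>
     (\<exists>\<A>n :: nat \<Rightarrow> 'x set set.
        (\<forall>n. finite_subsemilattice (\<A>n n) \<A>) \<and>
        (\<forall>A\<in>\<A>. \<exists>An :: nat \<Rightarrow> 'x set.
           (\<forall>n. An n \<in> finite_unions (\<A>n n) \<and> A \<subseteq> interior (An n)) \<and> A = (\<Inter>n. An n)))"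

text \<open>In the clause on finite additivity in distribution, \<open>i 0 = 0 < i 1 < \<dots> < i m \<le> i (m + 1) = k\<close>
  are the cut points; the last block is empty when \<open>i m = k\<close>.\<close>

definition random_prob_measure :: "'w measure \<Rightarrow> ('x::t2_space set \<Rightarrow> 'w \<Rightarrow> real) \<Rightarrow> bool" where
  "random_prob_measure M P \<longleftrightarrow>
     (\<forall>A\<in>sets borel. P A \<in> borel_measurable M \<and> (\<forall>\<omega>\<in>space M. P A \<omega> \<in> {0..1})) \<and>
     (\<forall>(k::nat) (m::nat) (i::nat \<Rightarrow> nat) (A::nat \<Rightarrow> 'x set).
        1 \<le> k \<longrightarrow> A ` {1..k} \<subseteq> sets borel \<longrightarrow> disjoint_family_on A {1..k} \<longrightarrow>
        i 0 = 0 \<longrightarrow> (\<forall>l<m. i l < i (l + 1)) \<longrightarrow> i m \<le> k \<longrightarrow> i (m + 1) = k \<longrightarrow>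
        distr M (\<Pi>\<^sub>M l\<in>{0..m}. borel) (\<lambda>\<omega>. \<lambda>l\<in>{0..m}. P (\<Union>j\<in>{i l + 1..i (l + 1)}. A j) \<omega>) =
        distr M (\<Pi>\<^sub>M l\<in>{0..m}. borel) (\<lambda>\<omega>. \<lambda>l\<in>{0..m}. \<Sum>j\<in>{i l + 1..i (l + 1)}. P (A j) \<omega>)) \<and>
     (AE \<omega> in M. P UNIV \<omega> = 1) \<and>
     (\<forall>A :: nat \<Rightarrow> 'x set. range A \<subseteq> sets borel \<longrightarrow> decseq A \<longrightarrow> (\<Inter>n. A n) = {} \<longrightarrow>
        (AE \<omega> in M. (\<lambda>n. P (A n) \<omega>) \<longlonglongrightarrow> 0))"

definition rel_incr :: "('x set \<Rightarrow> 'w \<Rightarrow> real) \<Rightarrow> 'x set \<Rightarrow> 'x set \<Rightarrow> 'w \<Rightarrow> real" where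
  "rel_incr P B1 B2 \<omega> = (if P B1 \<omega> < 1 then (P B2 \<omega> - P B1 \<omega>) / (1 - P B1 \<omega>) else 1)"

definition neutral_to_the_right ::
  "'w measure \<Rightarrow> 'x set set \<Rightarrow> ('x set \<Rightarrow> 'w \<Rightarrow> real) \<Rightarrow> bool" where
  "neutral_to_the_right M \<A> P \<longleftrightarrow>
     (\<forall>(k::nat) (B::nat \<Rightarrow> 'x set). 1 \<le> k \<longrightarrow> (\<forall>i\<in>{1..k}. B i \<in> finite_unions \<A>) \<longrightarrow>
        (\<forall>i\<in>{1..<k}. B i \<subseteq> B (i + 1)) \<longrightarrow>
        prob_space.indep_vars M (\<lambda>_. borel)
          (\<lambda>i. if i = 1 then P (B 1) else rel_incr P (B (i - 1)) (B i)) {1..k})"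

text \<open>The \<open>\<sigma>\<close>-field on \<^term>\<open>space M\<close> generated by the random variables \<open>Y i\<close>, \<open>i \<in> I\<close>,
  with values in \<open>N\<close>.\<close>

definition gen_sigma :: "'w measure \<Rightarrow> 'b measure \<Rightarrow> 'i set \<Rightarrow> ('i \<Rightarrow> 'w \<Rightarrow> 'b) \<Rightarrow> 'w measure" where
  "gen_sigma M N I Y = sigma (space M) {Y i -` S \<inter> space M |i S. i \<in> I \<and> S \<in> sets N}"

definition F_sigma :: "'w measure \<Rightarrow> 'x set set \<Rightarrow> ('x set \<Rightarrow> 'w \<Rightarrow> real) \<Rightarrow> 'x set \<Rightarrow> 'w measure" where
  "F_sigma M \<A> P B1 = gen_sigma M borel {A \<in> \<A>. A \<subseteq> B1} P"

definition sample_from ::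
  "'w measure \<Rightarrow> ('x::t2_space set \<Rightarrow> 'w \<Rightarrow> real) \<Rightarrow> nat \<Rightarrow> (nat \<Rightarrow> 'w \<Rightarrow> 'x) \<Rightarrow> bool" where
  "sample_from M P n X \<longleftrightarrow>
     (\<forall>i\<in>{1..n}. X i \<in> measurable M borel) \<and>
     (\<forall>A :: nat \<Rightarrow> 'x set. (\<forall>i\<in>{1..n}. A i \<in> sets borel) \<longrightarrow>
        (AE \<omega> in M.
           real_cond_exp M (gen_sigma M borel (sets borel) P)
             (indicator {\<omega>\<in>space M. \<forall>i\<in>{1..n}. X i \<omega> \<in> A i}) \<omega> = (\<Prod>i\<in>{1..n}. P (A i) \<omega>)))"

text \<open>Conditional independence of the sub-\<open>\<sigma>\<close>-fields \<open>H1\<close> and \<open>H2\<close> given the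
  sub-\<open>\<sigma>\<close>-field \<open>G\<close>.\<close>

definition cond_indep :: "'w measure \<Rightarrow> 'w measure \<Rightarrow> 'w measure \<Rightarrow> 'w measure \<Rightarrow> bool" where
  "cond_indep M G H1 H2 \<longleftrightarrow>
     (\<forall>a\<in>sets H1. \<forall>b\<in>sets H2. AE \<omega> in M.
        real_cond_exp M G (indicator (a \<inter> b)) \<omega> =
        real_cond_exp M G (indicator a) \<omega> * real_cond_exp M G (indicator b) \<omega>)"

definition posterior_neutral_to_the_right ::
  "'w measure \<Rightarrow> 'x::t2_space set set \<Rightarrow> ('x set \<Rightarrow> 'w \<Rightarrow> real) \<Rightarrow> nat \<Rightarrow> (nat \<Rightarrow> 'w \<Rightarrow> 'x) \<Rightarrow> bool" where
  "posterior_neutral_to_the_right M \<A> P n X \<longleftrightarrow>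
     (\<forall>B1\<in>finite_unions \<A>. \<forall>B2\<in>finite_unions \<A>. B1 \<subseteq> B2 \<longrightarrow>
        cond_indep M (gen_sigma M borel {1..n} X)
          (vimage_algebra (space M) (rel_incr P B1 B2) borel) (F_sigma M \<A> P B1))"

end

theory Submission
  imports Defs
begin

text \<open>Fix \<open>B = B1\<close> with \<open>P B < 1\<close> a.s.; otherwise \<open>P B = 1\<close> a.s. and \<open>V\<close> is constant. Chains in
  \<open>\<A>(u)\<close> through \<open>B\<close> that refine a given finite family show that \<open>F\<^sub>B\<close> is independent of the
  \<open>\<sigma>\<close>-field generated by all \<open>V\<close> between \<open>B\<close> and larger sets. Up to null sets, the former contains
  \<open>P (A \<inter> B)\<close> and the latter \<open>P (A - B) / (1 - P B)\<close>, for every Borel set \<open>A\<close>. On the event that the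
  sample points in \<open>B\<close> are exactly those with index in \<open>S\<close>, the joint law of \<open>P\<close> and the sample
  therefore factorises: what happens inside \<open>B\<close>, including those points, is independent of the
  relative masses outside \<open>B\<close>, including the other points. Conditioning on the sample preserves this,
  and the finitely many events are determined by the sample.\<close>

section \<open>Generated and augmented sub-\<open>\<sigma>\<close>-fields\<close>

text \<open>No version of \<open>P\<close> whose paths are measures is constructed, and no regular
  conditional distribution: the exceptional null set of each additivity identity depends on the sets
  involved. Measurability of masses is therefore claimed only up to null sets, which is harmless
  because independence survives the passage to \<open>augment\<close>.

  The obstacle is that a sample point may fall in \<open>B\<close> or outside it, so under
  \<open>M\<close> itself the sample does not split into two independent parts. Once it is fixed
  which points lie in \<open>B\<close>, the product of their masses has an inner and an outer
  factor. The only mixed term is a power of \<open>1 - P B\<close>, one factor for each outer point;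
  it is counted as inner, since \<open>P B\<close> is known inside \<open>B\<close>. The two factors
  are not normalised, but a cross-multiplied form of independence makes normalising constants
  cancel. As each such event lies in the field of the sample, conditional expectations given the
  sample may be computed under the measure conditioned on that event.\<close>

lemma space_gen_sigma [simp]: "space (gen_sigma M N I Y) = space M"
  by (simp add: gen_sigma_def space_measure_of_conv)

lemma sets_gen_sigma:
  "sets (gen_sigma M N I Y) = sigma_sets (space M) {Y i -` S \<inter> space M |i S. i \<in> I \<and> S \<in> sets N}"
  by (auto simp: gen_sigma_def intro!: sets_measure_of)

lemma measurable_gen_sigma:
  assumes "i \<in> I" "Y i \<in> measurable M N"
  shows "Y i \<in> measurable (gen_sigma M N I Y) N"
  using assms by (auto simp: measurable_def sets_gen_sigma)

lemma gen_sigma_least: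
  assumes "space G = space M" and "\<And>i. i \<in> I \<Longrightarrow> Y i \<in> measurable G N"
  shows "sets (gen_sigma M N I Y) \<subseteq> sets G"
  unfolding sets_gen_sigma assms(1)[symmetric]
  using assms(2) by (intro sets.sigma_sets_subset) (auto dest: measurable_sets)

lemma subalgebra_gen_sigma:
  assumes "\<And>i. i \<in> I \<Longrightarrow> Y i \<in> measurable M N"
  shows "subalgebra M (gen_sigma M N I Y)"
  using gen_sigma_least[of M M I Y N] assms by (simp add: subalgebra_def)

text \<open>Brings the field of the whole sample into the shape that
  \<open>real_cond_exp_indep_Int\<close> asks for: it is generated by intersections of an event
  about the points inside \<open>B\<close> with an event about the points outside.\<close>

lemma sets_gen_sigma_Un:
  "sets (gen_sigma M N (I \<union> J) Y) =
    sigma_sets (space M) {c \<inter> d |c d. c \<in> sets (gen_sigma M N I Y) \<and> d \<in> sets (gen_sigma M N J Y)}"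
  (is "?L = sigma_sets _ ?R")
proof
  have top: "space M \<in> sets (gen_sigma M N K Y)" for K
    using sets.top[of "gen_sigma M N K Y"] by simp
  have gen: "Y i -` S \<inter> space M \<in> sets (gen_sigma M N K Y)" if "i \<in> K" "S \<in> sets N" for i S K
    unfolding sets_gen_sigma using that by (intro sigma_sets.Basic) blast
  show "?L \<subseteq> sigma_sets (space M) ?R"
    unfolding sets_gen_sigma[of M N "I \<union> J"]
  proof (rule sigma_sets_mono', rule subsetI)
    fix s assume "s \<in> {Y i -` S \<inter> space M |i S. i \<in> I \<union> J \<and> S \<in> sets N}"
    then obtain i S where s: "s = Y i -` S \<inter> space M" and i: "i \<in> I \<union> J" and S: "S \<in> sets N"
      by blast
    have "s = s \<inter> space M" "s = space M \<inter> s" by (auto simp: s)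
    moreover have "s \<in> sets (gen_sigma M N I Y) \<or> s \<in> sets (gen_sigma M N J Y)"
      using gen[OF _ S] i unfolding s by blast
    ultimately show "s \<in> ?R" using top by blast
  qed
  have "sets (gen_sigma M N K Y) \<subseteq> ?L" if "K \<subseteq> I \<union> J" for K
    unfolding sets_gen_sigma using that by (intro sigma_sets_mono') blast
  then have "?R \<subseteq> ?L" by (blast intro: sets.Int)
  then show "sigma_sets (space M) ?R \<subseteq> ?L"
    using sets.sigma_sets_subset[of ?R "gen_sigma M N (I \<union> J) Y"] by simp
qed

lemma measurable_mono_sets:
  "f \<in> measurable G N \<Longrightarrow> sets G \<subseteq> sets G' \<Longrightarrow> space G = space G' \<Longrightarrow> f \<in> measurable G' N"
  by (auto simp: measurable_def)

text \<open>A completion relative to \<open>M\<close> that stays inside \<open>sets M\<close>. For a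
  sub-\<sigma>-field \<open>G\<close> the generating family is already a \<sigma>-field, see
  \<open>sets_augment\<close>.\<close>

definition augment :: "'w measure \<Rightarrow> 'w measure \<Rightarrow> 'w measure" where
  "augment M G = sigma (space M) {A \<in> sets M. \<exists>B\<in>sets G. AE x in M. x \<in> A \<longleftrightarrow> x \<in> B}"

lemma space_augment [simp]: "space (augment M G) = space M"
  by (simp add: augment_def space_measure_of_conv)

lemma sets_augment:
  assumes "subalgebra M G"
  shows "sets (augment M G) = {A \<in> sets M. \<exists>B\<in>sets G. AE x in M. x \<in> A \<longleftrightarrow> x \<in> B}"
    (is "_ = ?A")
proof -
  have sp: "space G = space M" and sub: "sets G \<subseteq> sets M"
    using assms by (auto simp: subalgebra_def)
  have "sigma_algebra (space M) ?A"
    unfolding sigma_algebra_iff2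
  proof (intro conjI ballI allI impI)
    show "?A \<subseteq> Pow (space M)"
      using sets.sets_into_space by auto
    show "{} \<in> ?A"
      by (auto intro!: bexI[of _ "{}"])
    fix s assume "s \<in> ?A"
    then obtain B where B: "s \<in> sets M" "B \<in> sets G" "AE x in M. x \<in> s \<longleftrightarrow> x \<in> B" by auto
    have "space M - B \<in> sets G"
      using B(2) sets.compl_sets[of B G] by (simp add: sp)
    moreover have "AE x in M. x \<in> space M - s \<longleftrightarrow> x \<in> space M - B"
      using B(3) by eventually_elim auto
    moreover have "space M - s \<in> sets M"
      using B(1) by auto
    ultimately show "space M - s \<in> ?A"
      by blast
  next
    fix A :: "nat \<Rightarrow> _" assume "range A \<subseteq> ?A"
    then have "\<forall>n. A n \<in> sets M \<and> (\<exists>B\<in>sets G. AE x in M. x \<in> A n \<longleftrightarrow> x \<in> B)"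
      by blast
    then obtain B where B: "\<And>n. A n \<in> sets M" "\<And>n. B n \<in> sets G"
      "\<And>n. AE x in M. x \<in> A n \<longleftrightarrow> x \<in> B n"
      by metis
    have "AE x in M. \<forall>n. x \<in> A n \<longleftrightarrow> x \<in> B n"
      using B(3) by (simp add: AE_all_countable)
    then have "AE x in M. x \<in> \<Union>(range A) \<longleftrightarrow> x \<in> \<Union>(range B)"
      by eventually_elim auto
    moreover have "\<Union>(range B) \<in> sets G" "\<Union>(range A) \<in> sets M"
      using B by auto
    ultimately show "\<Union>(range A) \<in> ?A"
      by blast
  qed
  then show ?thesis
    unfolding augment_def by (simp add: sigma_algebra.sets_measure_of_eq)
qed

lemma subalgebra_augment: "subalgebra M G \<Longrightarrow> subalgebra M (augment M G)"
  by (auto simp: subalgebra_def sets_augment)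

lemma sets_augment_superset: "subalgebra M G \<Longrightarrow> sets G \<subseteq> sets (augment M G)"
  by (auto simp: sets_augment subalgebra_def)

lemma measurable_augmentI:
  assumes "subalgebra M G" "f \<in> measurable G N"
  shows "f \<in> measurable (augment M G) N"
  by (rule measurable_mono_sets[OF assms(2) sets_augment_superset[OF assms(1)]])
    (use assms(1) in \<open>simp add: subalgebra_def\<close>)

text \<open>This is what the augmentation is for: identities between masses hold only almost surely,
  and here such an identity carries measurability from one side to the other.\<close>

lemma measurable_augment_cong_AE:
  assumes G: "subalgebra M G" and u: "u \<in> measurable (augment M G) N"
    and v: "v \<in> measurable M N" and eq: "AE x in M. u x = v x"
  shows "v \<in> measurable (augment M G) N"
proof (rule measurableI)
  show "v x \<in> space N" if "x \<in> space (augment M G)" for x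
    using that v by (auto simp: measurable_def)
  fix S assume S: "S \<in> sets N"
  have "u -` S \<inter> space M \<in> sets (augment M G)"
    using measurable_sets[OF u S] by simp
  then obtain B where B: "B \<in> sets G" "AE x in M. x \<in> u -` S \<inter> space M \<longleftrightarrow> x \<in> B"
    using G by (auto simp: sets_augment)
  have "AE x in M. x \<in> v -` S \<inter> space M \<longleftrightarrow> x \<in> B"
    using B(2) eq by eventually_elim auto
  moreover have "v -` S \<inter> space M \<in> sets M"
    using v S by (rule measurable_sets)
  ultimately show "v -` S \<inter> space (augment M G) \<in> sets (augment M G)"
    using G B(1) by (auto simp: sets_augment)
qed

text \<open>The total function \<open>lim\<close> is measurable for the augmented field; its
  unspecified values at divergent sequences matter only on a null set.\<close>

lemma measurable_augment_lim:
  fixes u :: "nat \<Rightarrow> 'w \<Rightarrow> real"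
  assumes "subalgebra M G" "\<And>n. u n \<in> borel_measurable (augment M G)"
    and "v \<in> borel_measurable M" "AE x in M. (\<lambda>n. u n x) \<longlonglongrightarrow> v x"
  shows "v \<in> borel_measurable (augment M G)"
proof (rule measurable_augment_cong_AE[OF assms(1) _ assms(3)])
  show "(\<lambda>x. lim (\<lambda>n. u n x)) \<in> borel_measurable (augment M G)"
    by (intro borel_measurable_lim_metric assms(2))
  show "AE x in M. lim (\<lambda>n. u n x) = v x"
    using assms(4) by eventually_elim (rule limI)
qed

section \<open>Independence of generated and augmented fields\<close>

context prob_space
begin

lemma indep_set_augment:
  assumes "subalgebra M G" "subalgebra M H" "indep_set (sets G) (sets H)"
  shows "indep_set (sets (augment M G)) (sets (augment M H))"
proof (rule indep_setI)
  show "sets (augment M G) \<subseteq> events" "sets (augment M H) \<subseteq> events"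
    using assms(1,2) by (auto simp: sets_augment)
  fix a b assume "a \<in> sets (augment M G)" "b \<in> sets (augment M H)"
  then obtain a' b' where *: "a \<in> events" "a' \<in> sets G" "AE x in M. x \<in> a \<longleftrightarrow> x \<in> a'"
    "b \<in> events" "b' \<in> sets H" "AE x in M. x \<in> b \<longleftrightarrow> x \<in> b'"
    using assms(1,2) by (auto simp: sets_augment)
  have ev: "a' \<in> events" "b' \<in> events"
    using * assms(1,2) by (auto simp: subalgebra_def)
  have "prob a = prob a'" "prob b = prob b'"
    by (rule measure_eq_AE; use * ev in simp)+
  moreover have "prob (a \<inter> b) = prob (a' \<inter> b')"
    by (rule measure_eq_AE) (use * ev in auto)
  ultimately show "prob (a \<inter> b) = prob a * prob b"
    using indep_setD[OF assms(3) *(2,5)] by simp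
qed

lemma indep_set_mono:
  assumes "indep_set A B" "A' \<subseteq> A" "B' \<subseteq> B"
  shows "indep_set A' B'"
  using assms unfolding indep_sets2_eq by blast

text \<open>A chain can accommodate only finitely many sets, so independence is first available for
  finite subfamilies. Their fields form a directed family, because those of \<open>J\<close> and
  \<open>J'\<close> lie in that of \<open>J \<union> J'\<close>; hence their union is a \<pi>-system
  generating the full field.\<close>

lemma indep_set_gen_sigma_finite:
  assumes fin: "\<And>J. finite J \<Longrightarrow> J \<subseteq> I \<Longrightarrow> indep_set (sets (gen_sigma M N J Y)) B"
    and B: "Int_stable B" "sigma_sets (space M) B = B"
  shows "indep_set (sets (gen_sigma M N I Y)) B"
proof -
  let ?U = "\<Union>J\<in>{J. finite J \<and> J \<subseteq> I}. sets (gen_sigma M N J Y)"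
  have mono: "sets (gen_sigma M N J Y) \<subseteq> sets (gen_sigma M N J' Y)" if "J \<subseteq> J'" for J J'
    unfolding sets_gen_sigma using that by (intro sigma_sets_mono') auto
  have "indep_set ?U B"
    \<comment> \<open>The instance \<open>J = {}\<close> tells that \<open>B\<close> consists of
      events.\<close>
    using fin[of "{}"] fin by (auto simp: indep_sets2_eq)
  moreover have "Int_stable ?U"
  proof (rule Int_stableI)
    fix a b assume "a \<in> ?U" "b \<in> ?U"
    then obtain J J' where *: "finite J" "J \<subseteq> I" "a \<in> sets (gen_sigma M N J Y)"
      "finite J'" "J' \<subseteq> I" "b \<in> sets (gen_sigma M N J' Y)" by auto
    then have "a \<inter> b \<in> sets (gen_sigma M N (J \<union> J') Y)"
      using mono[of J "J \<union> J'"] mono[of J' "J \<union> J'"] by blast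
    then show "a \<inter> b \<in> ?U"
      using * by (auto intro!: bexI[of _ "J \<union> J'"])
  qed
  ultimately have "indep_set (sigma_sets (space M) ?U) (sigma_sets (space M) B)"
    using B(1) by (rule indep_set_sigma_sets)
  moreover have "sets (gen_sigma M N I Y) \<subseteq> sigma_sets (space M) ?U"
    unfolding sets_gen_sigma[of M N I]
  proof (rule sigma_sets_mono', safe)
    fix i S assume "i \<in> I" "S \<in> sets N"
    then show "Y i -` S \<inter> space M \<in> ?U"
      by (intro UN_I[of "{i}"]) (auto simp: sets_gen_sigma)
  qed
  ultimately show ?thesis
    unfolding B(2) by (rule indep_set_mono) simp
qed

text \<open>The one-sided reduction acts on the first field, so it is applied twice with the two
  fields exchanged in between.\<close>

lemma indep_set_gen_sigma_finite2:
  assumes "\<And>J J'. finite J \<Longrightarrow> J \<subseteq> I \<Longrightarrow> finite J' \<Longrightarrow> J' \<subseteq> I' \<Longrightarrow>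
      indep_set (sets (gen_sigma M N J Y)) (sets (gen_sigma M N' J' Y'))"
  shows "indep_set (sets (gen_sigma M N I Y)) (sets (gen_sigma M N' I' Y'))"
proof -
  have comm: "indep_set B A" if "indep_set A B" for A B
  proof (rule indep_setI)
    fix b a assume "b \<in> B" "a \<in> A"
    then show "prob (b \<inter> a) = prob b * prob a"
      using indep_setD[OF that, of a b] by (simp add: Int_commute mult.commute)
  qed (use that in \<open>auto simp: indep_sets2_eq\<close>)
  have S: "Int_stable (sets G)" "sigma_sets (space M) (sets G) = sets G" if "space G = space M" for G
    using sets.sigma_sets_eq[of G] that by (auto simp: Int_stable_def)
  show ?thesis
  proof (rule indep_set_gen_sigma_finite)
    fix J assume J: "finite J" "J \<subseteq> I"
    have "indep_set (sets (gen_sigma M N' I' Y')) (sets (gen_sigma M N J Y))"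
      by (rule indep_set_gen_sigma_finite) (simp_all add: S comm assms J)
    then show "indep_set (sets (gen_sigma M N J Y)) (sets (gen_sigma M N' I' Y'))"
      by (rule comm)
  qed (simp_all add: S)
qed

lemma indep_set_integral_mult:
  fixes u v :: "'a \<Rightarrow> real"
  assumes "subalgebra M G" "subalgebra M H" "indep_set (sets G) (sets H)"
    and "u \<in> borel_measurable G" "v \<in> borel_measurable H" "integrable M u" "integrable M v"
  shows "expectation (\<lambda>x. u x * v x) = expectation u * expectation v"
proof -
  have sp: "space G = space M" "space H = space M"
    using assms by (auto simp: subalgebra_def)
  have "indep_set (sigma_sets (space M) {u -` A \<inter> space M | A. A \<in> sets borel})
        (sigma_sets (space M) {v -` A \<inter> space M | A. A \<in> sets borel})"
    using measurable_sets[OF assms(4)] measurable_sets[OF assms(5)] sp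
      sets.sigma_sets_subset[of "{u -` A \<inter> space M | A. A \<in> sets borel}" G]
      sets.sigma_sets_subset[of "{v -` A \<inter> space M | A. A \<in> sets borel}" H]
    by (intro indep_set_mono[OF assms(3)]) auto
  then have "indep_var borel u borel v"
    using assms(6,7) by (simp add: indep_var_eq)
  then show ?thesis
    using assms(6,7) by (rule indep_var_lebesgue_integral)
qed

end

section \<open>Conditional independence\<close>

lemma subalgebra_trans: "subalgebra M N \<Longrightarrow> subalgebra N G \<Longrightarrow> subalgebra M G"
  by (auto simp: subalgebra_def)

context prob_space
begin

lemma finite_measure_subalgebraI: "subalgebra M G \<Longrightarrow> finite_measure_subalgebra M G"
  by (simp add: finite_measure_subalgebra_axioms_def finite_measure_subalgebra_def finite_measure_axioms)

lemma integrable_indicator_events: "a \<in> events \<Longrightarrow> integrable M (indicator a :: 'a \<Rightarrow> real)"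
  by (simp add: less_top[symmetric])

text \<open>The sets on which the two integrals agree form a Dynkin class. Membership of
  \<open>space M\<close> in \<open>R\<close> gives equality of the total integrals, on which closure
  under complements rests.\<close>

lemma set_integral_eqI_pi_system:
  fixes f g :: "'a \<Rightarrow> real"
  assumes int: "integrable M f" "integrable M g"
    and R: "Int_stable R" "R \<subseteq> events" "space M \<in> R"
    and eq: "\<And>C. C \<in> R \<Longrightarrow> (\<integral>x\<in>C. f x \<partial>M) = (\<integral>x\<in>C. g x \<partial>M)"
    and A: "A \<in> sigma_sets (space M) R"
  shows "(\<integral>x\<in>A. f x \<partial>M) = (\<integral>x\<in>A. g x \<partial>M)"
proof -
  have R': "R \<subseteq> Pow (space M)"
    using R(2) sets.sets_into_space by auto
  have ev: "B \<in> events" if "B \<in> sigma_sets (space M) R" for B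
    using that R(2) sets.sigma_sets_subset by blast
  have si: "set_integrable M B h" if "integrable M h" "B \<in> events" for B and h :: "'a \<Rightarrow> real"
    unfolding set_integrable_def using that by (blast intro: integrable_mult_indicator)
  show ?thesis
    using R(1) R' A
  proof (induction rule: sigma_sets_induct_disjoint)
    case (basic A)
    then show ?case by (rule eq)
  next
    case empty
    show ?case by (simp add: set_lebesgue_integral_def)
  next
    case (compl A)
    have A: "A \<in> events"
      using compl by (intro ev)
    have *: "(\<integral>x\<in>space M - A. h x \<partial>M) = (\<integral>x\<in>space M. h x \<partial>M) - (\<integral>x\<in>A. h x \<partial>M)"
      if "integrable M h" for h :: "'a \<Rightarrow> real"
    proof -
      have "(\<integral>x\<in>(space M - A) \<union> A. h x \<partial>M) = (\<integral>x\<in>space M - A. h x \<partial>M) + (\<integral>x\<in>A. h x \<partial>M)"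
        using that A by (intro set_integral_Un si) auto
      moreover have "(space M - A) \<union> A = space M"
        using sets.sets_into_space[OF A] by auto
      ultimately show ?thesis by simp
    qed
    show ?case
      using compl eq[OF R(3)] by (simp add: *[OF int(1)] *[OF int(2)])
  next
    case (union A)
    have A: "A i \<in> events" for i
      using union(2) by (auto intro: ev)
    have disj: "i \<noteq> j \<Longrightarrow> A i \<inter> A j = {}" for i j
      using union(1) by (auto simp: disjoint_family_on_def)
    have "(\<Union>i. A i) \<in> events"
      using A by auto
    then show ?case
      using A disj by (simp add: lebesgue_integral_countable_add si int union.IH)
  qed
qed

text \<open>On a rectangle \<open>c \<inter> d\<close> both sides integrate to
  \<open>prob (a \<inter> c) * prob (b \<inter> d)\<close>: independence is used once to separate
  the indicators and once more to recombine the two conditional expectations. The rectangles form a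
  \<pi>-system that generates \<open>G\<close>.\<close>

lemma real_cond_exp_indep_Int:
  assumes sub: "subalgebra M N1" "subalgebra M N2" "subalgebra N1 G1" "subalgebra N2 G2"
      "subalgebra M G"
    and indep: "indep_set (sets N1) (sets N2)"
    and G: "sets G = sigma_sets (space M) {c \<inter> d |c d. c \<in> sets G1 \<and> d \<in> sets G2}"
    and ab: "a \<in> sets N1" "b \<in> sets N2"
  shows "AE x in M. real_cond_exp M G (indicator (a \<inter> b)) x =
      real_cond_exp M G1 (indicator a) x * real_cond_exp M G2 (indicator b) x"
proof -
  have sp: "space N1 = space M" "space N2 = space M" "space G1 = space M" "space G2 = space M"
    "space G = space M"
    using sub by (auto simp: subalgebra_def)
  have M1: "subalgebra M G1" and M2: "subalgebra M G2"
    using sub subalgebra_trans by blast+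
  interpret G1: finite_measure_subalgebra M G1 using M1 by (rule finite_measure_subalgebraI)
  interpret G2: finite_measure_subalgebra M G2 using M2 by (rule finite_measure_subalgebraI)
  interpret G: finite_measure_subalgebra M G using sub(5) by (rule finite_measure_subalgebraI)
  let ?R = "{c \<inter> d |c d. c \<in> sets G1 \<and> d \<in> sets G2}"
  let ?\<phi> = "real_cond_exp M G1 (indicator a)" and ?\<psi> = "real_cond_exp M G2 (indicator b)"
  have ev: "a \<in> events" "b \<in> events" "\<And>c. c \<in> sets G1 \<Longrightarrow> c \<in> events" "\<And>d. d \<in> sets G2 \<Longrightarrow> d \<in> events"
    and evN: "\<And>c. c \<in> sets G1 \<Longrightarrow> c \<in> sets N1" "\<And>d. d \<in> sets G2 \<Longrightarrow> d \<in> sets N2"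
    using ab sub M1 M2 by (auto simp: subalgebra_def)
  have int: "integrable M (indicator a :: _ \<Rightarrow> real)" "integrable M (indicator b :: _ \<Rightarrow> real)"
    "integrable M (indicator (a \<inter> b) :: _ \<Rightarrow> real)"
    using ev by (auto intro!: integrable_indicator_events)
  have int\<phi>: "integrable M ?\<phi>" "integrable M ?\<psi>"
    using int by (auto intro: G1.real_cond_exp_int G2.real_cond_exp_int)
  have b\<phi>: "AE x in M. \<bar>?\<phi> x\<bar> \<le> 1"
  proof -
    have "AE x in M. ?\<phi> x \<ge> 0" "AE x in M. ?\<phi> x \<le> 1"
      using int by (auto intro!: G1.real_cond_exp_ge_c G1.real_cond_exp_le_c split: split_indicator)
    then show ?thesis by eventually_elim auto
  qed
  have meas: "?\<phi> \<in> borel_measurable N1" "?\<psi> \<in> borel_measurable N2"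
    "?\<phi> \<in> borel_measurable G1" "?\<psi> \<in> borel_measurable G2"
    by (auto intro: measurable_from_subalg[OF sub(3)] measurable_from_subalg[OF sub(4)])
  have incl: "sets G1 \<subseteq> sets G" "sets G2 \<subseteq> sets G"
  proof -
    show "sets G1 \<subseteq> sets G"
    proof
      fix c assume c: "c \<in> sets G1"
      then have "c = c \<inter> space M" "space M \<in> sets G2"
        using sets.sets_into_space[OF c] sp sets.top[of G2] by auto
      with c show "c \<in> sets G"
        unfolding G by (intro sigma_sets.Basic) blast
    qed
    show "sets G2 \<subseteq> sets G"
    proof
      fix d assume d: "d \<in> sets G2"
      then have "d = space M \<inter> d" "space M \<in> sets G1"
        using sets.sets_into_space[OF d] sp sets.top[of G1] by auto
      with d show "d \<in> sets G"
        unfolding G by (intro sigma_sets.Basic) blast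
    qed
  qed
  have measG: "(\<lambda>x. ?\<phi> x * ?\<psi> x) \<in> borel_measurable G"
    using measurable_mono_sets[OF meas(3) incl(1)] measurable_mono_sets[OF meas(4) incl(2)] sp
    by (intro borel_measurable_times) auto
  have int\<phi>\<psi>: "integrable M (\<lambda>x. ?\<phi> x * ?\<psi> x)"
  proof (rule Bochner_Integration.integrable_bound)
    show "integrable M ?\<psi>" by fact
    show "(\<lambda>x. ?\<phi> x * ?\<psi> x) \<in> borel_measurable M"
      by measurable
    show "AE x in M. norm (?\<phi> x * ?\<psi> x) \<le> norm (?\<psi> x)"
      using b\<phi> by eventually_elim (simp add: abs_mult mult_left_le_one_le)
  qed
  have eq: "(\<integral>x\<in>c \<inter> d. (indicator (a \<inter> b) x :: real) \<partial>M) = (\<integral>x\<in>c \<inter> d. ?\<phi> x * ?\<psi> x \<partial>M)"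
    if cd: "c \<in> sets G1" "d \<in> sets G2" for c d
  proof -
    have "(\<integral>x\<in>c \<inter> d. (indicator (a \<inter> b) x :: real) \<partial>M) = (\<integral>x. indicator (c \<inter> a) x * indicator (d \<inter> b) x \<partial>M)"
      unfolding set_lebesgue_integral_def
      by (intro Bochner_Integration.integral_cong refl) (auto split: split_indicator)
    also have "\<dots> = (\<integral>x. indicator (c \<inter> a) x \<partial>M) * (\<integral>x. indicator (d \<inter> b) x \<partial>M)"
      by (intro indep_set_integral_mult[OF sub(1,2) indep] borel_measurable_indicator
          integrable_indicator_events sets.Int cd evN ab ev)
    also have "(\<integral>x. indicator (c \<inter> a) x \<partial>M) = (\<integral>x\<in>c. ?\<phi> x \<partial>M)"
      using G1.real_cond_exp_intA[OF int(1) cd(1)]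
      by (simp add: set_lebesgue_integral_def indicator_inter_arith)
    also have "(\<integral>x. indicator (d \<inter> b) x \<partial>M) = (\<integral>x\<in>d. ?\<psi> x \<partial>M)"
      using G2.real_cond_exp_intA[OF int(2) cd(2)]
      by (simp add: set_lebesgue_integral_def indicator_inter_arith)
    also have "(\<integral>x\<in>c. ?\<phi> x \<partial>M) * (\<integral>x\<in>d. ?\<psi> x \<partial>M) =
        (\<integral>x. (indicator c x * ?\<phi> x) * (indicator d x * ?\<psi> x) \<partial>M)"
      unfolding set_lebesgue_integral_def real_scaleR_def
    proof (rule indep_set_integral_mult[OF sub(1,2) indep, symmetric])
      show "(\<lambda>x. indicator c x * ?\<phi> x) \<in> borel_measurable N1"
        by (intro borel_measurable_times borel_measurable_indicator cd evN meas)
      show "(\<lambda>x. indicator d x * ?\<psi> x) \<in> borel_measurable N2"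
        by (intro borel_measurable_times borel_measurable_indicator cd evN meas)
      show "integrable M (\<lambda>x. indicator c x * ?\<phi> x)"
        using integrable_mult_indicator[OF ev(3)[OF cd(1)] int\<phi>(1)] by simp
      show "integrable M (\<lambda>x. indicator d x * ?\<psi> x)"
        using integrable_mult_indicator[OF ev(4)[OF cd(2)] int\<phi>(2)] by simp
    qed
    also have "\<dots> = (\<integral>x\<in>c \<inter> d. ?\<phi> x * ?\<psi> x \<partial>M)"
      unfolding set_lebesgue_integral_def
      by (intro Bochner_Integration.integral_cong refl) (auto split: split_indicator)
    finally show ?thesis .
  qed
  show ?thesis
  proof (rule G.real_cond_exp_charact[OF _ int(3) int\<phi>\<psi> measG])
    fix A assume "A \<in> sets G"
    then have "A \<in> sigma_sets (space M) ?R" by (simp add: G)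
    then show "(\<integral>x\<in>A. (indicator (a \<inter> b) x :: real) \<partial>M) = (\<integral>x\<in>A. ?\<phi> x * ?\<psi> x \<partial>M)"
    proof (rule set_integral_eqI_pi_system[OF int(3) int\<phi>\<psi>, rotated -1])
      show "Int_stable ?R"
      proof (rule Int_stableI)
        fix A B assume "A \<in> ?R" "B \<in> ?R"
        then obtain c d c' d' where "A = c \<inter> d" "B = c' \<inter> d'" "c \<in> sets G1" "d \<in> sets G2"
          "c' \<in> sets G1" "d' \<in> sets G2" by blast
        then show "A \<inter> B \<in> ?R"
          by (intro CollectI exI[of _ "c \<inter> c'"] exI[of _ "d \<inter> d'"]) auto
      qed
      show "?R \<subseteq> events" using ev by auto
      show "space M \<in> ?R"
        using sets.top[of G1] sets.top[of G2] sp by (intro CollectI exI[of _ "space M"]) auto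
    qed (use eq in blast)
  qed
qed

text \<open>Replacing \<open>a\<close> or \<open>b\<close> by the whole space in
  \<open>real_cond_exp_indep_Int\<close> shows that conditioning \<open>a\<close> on
  \<open>G\<close> is the same as conditioning it on \<open>G1\<close>, and \<open>b\<close>
  likewise on \<open>G2\<close>; the product formula then has the required form.\<close>

lemma cond_indep_indep:
  assumes sub: "subalgebra M N1" "subalgebra M N2" "subalgebra N1 G1" "subalgebra N2 G2"
      "subalgebra M G"
    and indep: "indep_set (sets N1) (sets N2)"
    and G: "sets G = sigma_sets (space M) {c \<inter> d |c d. c \<in> sets G1 \<and> d \<in> sets G2}"
  shows "cond_indep M G N2 N1"
  unfolding cond_indep_def
proof (intro ballI)
  fix b a assume ab: "b \<in> sets N2" "a \<in> sets N1"
  note main = real_cond_exp_indep_Int[OF assms]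
  have sp: "space N1 = space M" "space N2 = space M"
    using sub by (auto simp: subalgebra_def)
  have M1: "subalgebra M G1" and M2: "subalgebra M G2"
    using sub subalgebra_trans by blast+
  interpret G1: finite_measure_subalgebra M G1 using M1 by (rule finite_measure_subalgebraI)
  interpret G2: finite_measure_subalgebra M G2 using M2 by (rule finite_measure_subalgebraI)
  have top: "space M \<in> sets N1" "space M \<in> sets N2"
    using sets.top[of N1] sets.top[of N2] sp by auto
  have one: "AE x in M. real_cond_exp M G' (indicator (space M)) x = 1"
    if "subalgebra M G'" for G'
  proof -
    interpret finite_measure_subalgebra M G' using that by (rule finite_measure_subalgebraI)
    have "indicator (space M) \<in> borel_measurable G'"
      using that by (metis borel_measurable_indicator sets.top subalgebra_def)
    then have "AE x in M. real_cond_exp M G' (indicator (space M)) x = indicator (space M) x"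
      by (intro real_cond_exp_F_meas integrable_indicator_events) auto
    then show ?thesis
      using AE_space by eventually_elim simp
  qed
  have inter: "a \<inter> space M = a" "space M \<inter> b = b"
    using ab sets.sets_into_space sp by blast+
  show "AE x in M. real_cond_exp M G (indicator (b \<inter> a)) x =
      real_cond_exp M G (indicator b) x * real_cond_exp M G (indicator a) x"
    using main[OF ab(2,1)] main[OF ab(2) top(2)] main[OF top(1) ab(1)] one[OF M1] one[OF M2]
    unfolding inter by eventually_elim (simp add: Int_commute mult.commute)
qed

section \<open>Conditioning on an event of the given field\<close>

lemma integral_uniform_measure:
  fixes f :: "'a \<Rightarrow> real"
  assumes "f \<in> borel_measurable M" "E \<in> events" "prob E > 0"
  shows "(\<integral>x. f x \<partial>uniform_measure M E) = (\<integral>x\<in>E. f x \<partial>M) / prob E"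
proof -
  have "uniform_measure M E = density M (\<lambda>x. ennreal (indicator E x / prob E))"
    unfolding uniform_measure_def using assms(3)
    by (intro arg_cong2[where f=density] refl ext)
      (auto simp: emeasure_eq_measure divide_ennreal split: split_indicator simp flip: ennreal_1)
  then show ?thesis
    using assms by (simp add: integral_density set_lebesgue_integral_def divide_inverse
        flip: Bochner_Integration.integral_mult_left_zero) (simp add: mult_ac)
qed

text \<open>Because \<open>E\<close> belongs to \<open>G\<close>, every test set \<open>A\<close> of
  \<open>G\<close> may be replaced by \<open>E \<inter> A\<close>, which is again a test set; the
  factor \<open>1 / prob E\<close> then appears on both sides.\<close>

lemma real_cond_exp_uniform_measure:
  assumes sub: "subalgebra M G" and E: "E \<in> sets G" "prob E > 0" and a: "a \<in> events"
  shows "AE x in M. x \<in> E \<longrightarrow>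
    real_cond_exp (uniform_measure M E) G (indicator a) x = real_cond_exp M G (indicator a) x"
proof -
  let ?Q = "uniform_measure M E"
  have Eev: "E \<in> events"
    using sub E by (auto simp: subalgebra_def)
  have Epos: "emeasure M E \<noteq> 0" "emeasure M E < \<infinity>"
    using E(2) by (auto simp: emeasure_eq_measure)
  interpret Q: prob_space ?Q
    using Epos by (intro prob_space_uniform_measure) auto
  interpret G: finite_measure_subalgebra M G using sub by (rule finite_measure_subalgebraI)
  have "subalgebra ?Q G" using sub by (simp add: subalgebra_def)
  then interpret QG: finite_measure_subalgebra ?Q G by (rule Q.finite_measure_subalgebraI)
  have inta: "integrable M (indicator a :: _ \<Rightarrow> real)"
    using a by (rule integrable_indicator_events)
  let ?\<phi> = "real_cond_exp M G (indicator a)"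
  have b\<phi>: "AE x in M. \<bar>?\<phi> x\<bar> \<le> 1"
  proof -
    have "AE x in M. ?\<phi> x \<ge> 0" "AE x in M. ?\<phi> x \<le> 1"
      using inta by (auto intro!: G.real_cond_exp_ge_c G.real_cond_exp_le_c split: split_indicator)
    then show ?thesis by eventually_elim auto
  qed
  have "AE x in ?Q. real_cond_exp ?Q G (indicator a) x = ?\<phi> x"
  proof (rule QG.real_cond_exp_charact)
    show "integrable ?Q (indicator a :: _ \<Rightarrow> real)"
      using a by (intro Q.integrable_indicator_events) simp
    show "integrable ?Q ?\<phi>"
      using b\<phi> by (intro Q.integrable_const_bound[of _ 1] AE_uniform_measureI Eev) auto
    show "?\<phi> \<in> borel_measurable G" by simp
    fix A assume A: "A \<in> sets G"
    then have Aev: "A \<in> events" using sub by (auto simp: subalgebra_def)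
    have int: "(\<integral>x\<in>A. f x \<partial>?Q) = (\<integral>x\<in>E \<inter> A. f x \<partial>M) / prob E" if "f \<in> borel_measurable M"
      for f :: "'a \<Rightarrow> real"
      unfolding set_lebesgue_integral_def[of ?Q]
      using that Aev Eev E
      by (subst integral_uniform_measure)
        (auto simp: set_lebesgue_integral_def indicator_inter_arith mult.assoc)
    have "E \<inter> A \<in> sets G" using A E by auto
    then show "(\<integral>x\<in>A. (indicator a x :: real) \<partial>?Q) = (\<integral>x\<in>A. ?\<phi> x \<partial>?Q)"
      using a G.real_cond_exp_intA[OF inta, of "E \<inter> A"] by (simp add: int)
  qed
  then show ?thesis
    using Epos by (simp add: AE_uniform_measure)
qed

text \<open>On each cell the conditional expectations under \<open>M\<close> and under the
  conditioned measure agree, so the product formula holds there. Cells of probability zero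
  contribute only a null set.\<close>

lemma cond_indep_glue:
  assumes sub: "subalgebra M G" "subalgebra M H1" "subalgebra M H2"
    and fin: "finite \<E>" "\<E> \<subseteq> sets G" "space M \<subseteq> \<Union>\<E>"
    and indep: "\<And>E. E \<in> \<E> \<Longrightarrow> prob E > 0 \<Longrightarrow> cond_indep (uniform_measure M E) G H1 H2"
  shows "cond_indep M G H1 H2"
  unfolding cond_indep_def
proof (intro ballI)
  fix a b assume ab: "a \<in> sets H1" "b \<in> sets H2"
  then have ev: "a \<in> events" "b \<in> events" "a \<inter> b \<in> events"
    using sub by (auto simp: subalgebra_def)
  let ?eq = "\<lambda>x. real_cond_exp M G (indicator (a \<inter> b)) x =
      real_cond_exp M G (indicator a) x * real_cond_exp M G (indicator b) x"
  have "AE x in M. x \<in> E \<longrightarrow> ?eq x" if E: "E \<in> \<E>" for E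
  proof (cases "prob E > 0")
    case True
    have EG: "E \<in> sets G" using E fin by auto
    have Epos: "emeasure M E \<noteq> 0" "emeasure M E < \<infinity>"
      using True by (auto simp: emeasure_eq_measure)
    have "AE x in uniform_measure M E. real_cond_exp (uniform_measure M E) G (indicator (a \<inter> b)) x =
      real_cond_exp (uniform_measure M E) G (indicator a) x *
      real_cond_exp (uniform_measure M E) G (indicator b) x"
      using indep[OF E True] ab by (auto simp: cond_indep_def)
    then have "AE x in M. x \<in> E \<longrightarrow> real_cond_exp (uniform_measure M E) G (indicator (a \<inter> b)) x =
      real_cond_exp (uniform_measure M E) G (indicator a) x *
      real_cond_exp (uniform_measure M E) G (indicator b) x"
      using Epos by (simp add: AE_uniform_measure)
    then show ?thesis
      using real_cond_exp_uniform_measure[OF sub(1) EG True ev(1)]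
        real_cond_exp_uniform_measure[OF sub(1) EG True ev(2)]
        real_cond_exp_uniform_measure[OF sub(1) EG True ev(3)]
      by eventually_elim simp
  next
    case False
    then have "prob E = 0" using measure_nonneg[of M E] by linarith
    moreover have "E \<in> events" using E fin sub by (auto simp: subalgebra_def)
    ultimately have "E \<in> null_sets M" by (auto simp: null_sets_def emeasure_eq_measure)
    then show ?thesis by (auto dest: AE_not_in elim: eventually_mono)
  qed
  then have "AE x in M. \<forall>E\<in>\<E>. x \<in> E \<longrightarrow> ?eq x"
    by (subst AE_finite_all[OF fin(1)]) blast
  then show "AE x in M. ?eq x"
    using AE_space by eventually_elim (use fin(3) in blast)
qed

text \<open>Covers the degenerate case \<open>P B = 1\<close>. An event determined by an almost
  surely constant variable has an almost surely constant indicator, which can be taken out of every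
  conditional expectation.\<close>

lemma cond_indep_AE_const:
  fixes v :: "'a \<Rightarrow> real" and k :: real
  assumes sub: "subalgebra M G" "subalgebra M H2"
    and v: "v \<in> borel_measurable M" "AE x in M. v x = k"
  shows "cond_indep M G (vimage_algebra (space M) v borel) H2"
  unfolding cond_indep_def
proof (intro ballI)
  fix a b assume a: "a \<in> sets (vimage_algebra (space M) v borel)" and b: "b \<in> sets H2"
  from a obtain S where S: "S \<in> sets borel" "a = v -` S \<inter> space M"
    by (auto simp: sets_vimage_algebra2)
  have ev: "a \<in> events" "b \<in> events"
    using S v b sub by (auto simp: subalgebra_def)
  interpret G: finite_measure_subalgebra M G using sub(1) by (rule finite_measure_subalgebraI)
  define c :: real where "c = indicator S k"
  have eq: "AE x in M. indicator a x = c"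
    using v(2) AE_space by eventually_elim (auto simp: S c_def split: split_indicator)
  then have "AE x in M. real_cond_exp M G (indicator a) x = real_cond_exp M G (\<lambda>_. c) x"
    using ev by (intro G.real_cond_exp_cong) auto
  moreover have "AE x in M. real_cond_exp M G (\<lambda>_. c) x = c"
    by (intro G.real_cond_exp_F_meas) auto
  moreover have "AE x in M. real_cond_exp M G (indicator (a \<inter> b)) x =
      real_cond_exp M G (\<lambda>x. c * indicator b x) x"
    using eq ev by (intro G.real_cond_exp_cong) (auto simp: indicator_inter_arith elim: eventually_mono)
  moreover have "AE x in M. real_cond_exp M G (\<lambda>x. c * indicator b x) x =
      c * real_cond_exp M G (indicator b) x"
    using ev by (intro G.real_cond_exp_cmult integrable_indicator_events)
  ultimately show "AE x in M. real_cond_exp M G (indicator (a \<inter> b)) x =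
      real_cond_exp M G (indicator a) x * real_cond_exp M G (indicator b) x"
    by eventually_elim simp
qed

end

section \<open>Refining chains\<close>

text \<open>For a monotone \<open>C\<close> with \<open>C 0 \<subseteq> F\<close> this says that
  \<open>F\<close> consists of \<open>C 0\<close> and some of the first \<open>N\<close> steps of
  the chain, so its mass is a sum of increments. The sequence may go on after
  \<open>N\<close>.\<close>

definition refines :: "(nat \<Rightarrow> 'a set) \<Rightarrow> nat \<Rightarrow> 'a set \<Rightarrow> bool" where
  "refines C N F \<longleftrightarrow>
    F \<subseteq> C N \<and> (\<forall>i<N. C (Suc i) - C i \<subseteq> F \<or> (C (Suc i) - C i) \<inter> F = {})"

text \<open>Neutrality speaks of nested sets only, whereas the generators of the fields on either
  side of \<open>B\<close> need not be nested. Chains in the lattice \<open>L\<close> with least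
  element \<open>K\<close> bridge this gap: \<open>K\<close> is the empty set for the inner field
  and \<open>B\<close> for the outer one.\<close>

lemma refining_chain:
  fixes K :: "'a set"
  assumes "finite \<F>" "\<F> \<subseteq> L" "K \<in> L"
    and L: "\<And>A. A \<in> L \<Longrightarrow> K \<subseteq> A"
      "\<And>A B. A \<in> L \<Longrightarrow> B \<in> L \<Longrightarrow> A \<inter> B \<in> L" "\<And>A B. A \<in> L \<Longrightarrow> B \<in> L \<Longrightarrow> A \<union> B \<in> L"
  shows "\<exists>C N. C 0 = K \<and> range C \<subseteq> L \<and> mono C \<and> (\<forall>F\<in>\<F>. refines C N F)"
  using assms(1,2)
proof (induction rule: finite_induct)
  case empty
  have "mono (\<lambda>_::nat. K)" by (simp add: mono_def)
  then show ?case
    using assms(3) by (intro exI[of _ "\<lambda>_. K"]) simp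
next
  case (insert A \<F>)
  then obtain C N where C: "C 0 = K" "range C \<subseteq> L" "mono C" "\<forall>F\<in>\<F>. refines C N F"
    by auto
  have A: "A \<in> L" using insert by simp
  \<comment> \<open>Pass through the traces of the old chain on \<open>A\<close>, then through its unions with \<open>A\<close>.\<close>
  define D where "D i = (if i \<le> N then C i \<inter> A else C (i - Suc N) \<union> A)" for i
  have KA: "K \<subseteq> A" using L(1) A by blast
  have "D 0 = K" using C(1) KA by (auto simp: D_def)
  moreover have "D i \<in> L" for i
  proof -
    have "C i \<in> L" "C (i - Suc N) \<in> L" using C(2) by blast+
    then show ?thesis using A L(2,3) by (simp add: D_def)
  qed
  moreover have "mono D"
  proof (rule monoI)
    fix i j :: nat assume ij: "i \<le> j"
    have "C i \<subseteq> C j" "C (i - Suc N) \<subseteq> C (j - Suc N)"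
      using ij by (auto intro!: monoD[OF C(3)])
    then show "D i \<subseteq> D j" using ij by (auto simp: D_def)
  qed
  \<comment> \<open>\<open>N + 1\<close> traces are followed by \<open>N + 1\<close> unions, so the
    last index is \<open>2 * N + 1\<close>, where \<open>D\<close> equals
    \<open>C N \<union> A\<close>.\<close>
  moreover have "refines D (Suc (2 * N)) F" if F: "F \<in> insert A \<F>" for F
  proof -
    have ref: "F = A \<or> (F \<subseteq> C N \<and> (\<forall>i<N. C (Suc i) - C i \<subseteq> F \<or> (C (Suc i) - C i) \<inter> F = {}))"
      using F C(4) by (auto simp: refines_def)
    have "D (Suc i) - D i \<subseteq> F \<or> (D (Suc i) - D i) \<inter> F = {}" if i: "i < Suc (2 * N)" for i
    proof -
      consider "i < N" | "i = N" | "N < i" by linarith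
      then show ?thesis
      proof cases
        case 1
        then have D: "D (Suc i) - D i = (C (Suc i) - C i) \<inter> A" by (auto simp: D_def)
        from ref 1 have "F = A \<or> C (Suc i) - C i \<subseteq> F \<or> (C (Suc i) - C i) \<inter> F = {}" by blast
        then show ?thesis unfolding D by blast
      next
        case 2
        \<comment> \<open>The first union is \<open>C 0 \<union> A = A\<close>. This step thus
          completes \<open>A\<close> and adds only points outside \<open>C N\<close>, hence outside
          every old \<open>F\<close>.\<close>
        then have D: "D (Suc i) - D i = A - C N" using C(1) KA by (auto simp: D_def)
        from ref have "F = A \<or> F \<subseteq> C N" by blast
        then show ?thesis unfolding D by blast
      next
        case 3
        define j where "j = i - Suc N"
        have j: "j < N" using 3 i by (simp add: j_def)
        have "Suc i - Suc N = Suc j" using 3 by (simp add: j_def)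
        then have D: "D (Suc i) - D i = (C (Suc j) - C j) - A" using 3 by (auto simp: D_def j_def)
        from ref j have "F = A \<or> C (Suc j) - C j \<subseteq> F \<or> (C (Suc j) - C j) \<inter> F = {}" by blast
        then show ?thesis unfolding D by blast
      qed
    qed
    moreover have "F \<subseteq> D (Suc (2 * N))"
      using ref by (auto simp: D_def)
    ultimately show ?thesis by (simp add: refines_def)
  qed
  ultimately show ?case
    by (intro exI[of _ D] exI[of _ "Suc (2 * N)"]) blast
qed

section \<open>Random probability measures\<close>

locale random_measure = prob_space M for M :: "'w measure" +
  fixes P :: "'x::t2_space set \<Rightarrow> 'w \<Rightarrow> real"
  assumes random_prob_measure: "random_prob_measure M P"
begin

lemma P_measurable [measurable]: "A \<in> sets borel \<Longrightarrow> P A \<in> borel_measurable M"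
  and P_range: "A \<in> sets borel \<Longrightarrow> \<omega> \<in> space M \<Longrightarrow> 0 \<le> P A \<omega> \<and> P A \<omega> \<le> 1"
  and P_UNIV: "AE \<omega> in M. P UNIV \<omega> = 1"
  and P_decseq: "range B \<subseteq> sets borel \<Longrightarrow> decseq B \<Longrightarrow> (\<Inter>n. B n) = {} \<Longrightarrow>
        AE \<omega> in M. (\<lambda>n. P (B n) \<omega>) \<longlonglongrightarrow> 0"
proof -
  note * = random_prob_measure[unfolded random_prob_measure_def]
  show "P A \<in> borel_measurable M" if "A \<in> sets borel"
    using that by (rule conjunct1[OF bspec[OF conjunct1[OF *]]])
  show "0 \<le> P A \<omega> \<and> P A \<omega> \<le> 1" if "A \<in> sets borel" "\<omega> \<in> space M"
    using bspec[OF conjunct2[OF bspec[OF conjunct1[OF *] that(1)]] that(2)] by simp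
  show "AE \<omega> in M. P UNIV \<omega> = 1"
    by (rule conjunct1[OF conjunct2[OF conjunct2[OF *]]])
  show "AE \<omega> in M. (\<lambda>n. P (B n) \<omega>) \<longlonglongrightarrow> 0"
    if "range B \<subseteq> sets borel" "decseq B" "(\<Inter>n. B n) = {}"
    by (rule conjunct2[OF conjunct2[OF conjunct2[OF *]], rule_format, OF that])
qed

text \<open>The case \<open>m = 0\<close> of additivity in distribution merges all sets into one
  block of mass \<open>P UNIV\<close>. A variable with the law of an almost sure constant is itself
  almost surely that constant, so equality in law becomes an almost sure identity.\<close>

lemma P_partition:
  fixes A :: "nat \<Rightarrow> 'x set"
  assumes k: "1 \<le> k" and A: "A ` {1..k} \<subseteq> sets borel" "disjoint_family_on A {1..k}"
    "(\<Union>j\<in>{1..k}. A j) = UNIV"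
  shows "AE \<omega> in M. (\<Sum>j\<in>{1..k}. P (A j) \<omega>) = 1"
proof -
  define i :: "nat \<Rightarrow> nat" where "i l = (if l = 0 then 0 else k)" for l
  let ?N = "\<Pi>\<^sub>M l\<in>{0..0::nat}. (borel :: real measure)"
  let ?f = "\<lambda>\<omega>. \<lambda>l\<in>{0..0}. P (\<Union>j\<in>{i l + 1..i (l + 1)}. A j) \<omega>"
  let ?g = "\<lambda>\<omega>. \<lambda>l\<in>{0..0}. \<Sum>j\<in>{i l + 1..i (l + 1)}. P (A j) \<omega>"
  have i: "i 0 = 0" "\<forall>l<0. i l < i (l + 1)" "i 0 \<le> k" "i (0 + 1) = k"
    by (auto simp: i_def)
  have eq: "distr M ?N ?f = distr M ?N ?g"
    by (rule conjunct1[OF conjunct2[OF random_prob_measure[unfolded random_prob_measure_def]],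
          rule_format, OF k A(1,2) i(1) _ i(3,4)]) simp
  have i': "{i 0 + 1..i (0 + 1)} = {1..k}"
    by (simp add: i_def)
  have mf: "?f \<in> measurable M ?N"
  proof (rule measurable_restrict)
    fix l :: nat assume "l \<in> {0..0}"
    then show "P (\<Union>j\<in>{i l + 1..i (l + 1)}. A j) \<in> borel_measurable M"
      using A(1) by (intro P_measurable sets.finite_UN) (auto simp: i_def)
  qed
  have mg: "?g \<in> measurable M ?N"
  proof (rule measurable_restrict)
    fix l :: nat assume "l \<in> {0..0}"
    then show "(\<lambda>\<omega>. \<Sum>j\<in>{i l + 1..i (l + 1)}. P (A j) \<omega>) \<in> borel_measurable M"
      using A(1) by (intro borel_measurable_sum P_measurable) (auto simp: i_def)
  qed
  have S: "{f \<in> space ?N. f 0 = 1} \<in> sets ?N"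
    by measurable
  have "AE f in distr M ?N ?f. f 0 = 1"
    unfolding AE_distr_iff[OF mf S] using P_UNIV by (simp add: i_def A(3)[simplified])
  then show ?thesis
    unfolding eq AE_distr_iff[OF mg S] by (simp add: i_def)
qed

text \<open>Additivity is only assumed in distribution, but the total mass is a.s. equal to 1. Comparing
  the partitions \<open>A, B, - (A \<union> B)\<close> and \<open>A \<union> B, - (A \<union> B)\<close> turns this into a.s. additivity.\<close>

lemma P_Un:
  assumes [measurable]: "A \<in> sets borel" "B \<in> sets borel" and disj: "A \<inter> B = {}"
  shows "AE \<omega> in M. P (A \<union> B) \<omega> = P A \<omega> + P B \<omega>"
proof -
  define S :: "nat \<Rightarrow> 'x set" where
    "S j = (if j = 1 then A else if j = 2 then B else - (A \<union> B))" for j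
  define T :: "nat \<Rightarrow> 'x set" where "T j = (if j = 1 then A \<union> B else - (A \<union> B))" for j
  have atLeast: "{Suc 0..3} = {Suc 0, 2, 3}" "{Suc 0..2} = {Suc 0, 2}"
    by auto
  have "AE \<omega> in M. (\<Sum>j\<in>{1..3}. P (S j) \<omega>) = 1"
  proof (rule P_partition)
    show "disjoint_family_on S {1..3}"
      using disj by (simp add: disjoint_family_on_def atLeast S_def; blast)
    show "(\<Union>j\<in>{1..3}. S j) = UNIV"
      by (simp add: atLeast S_def; blast)
    show "S ` {1..3} \<subseteq> sets borel"
      using assms(1,2) by (simp add: atLeast S_def)
  qed simp
  moreover have "AE \<omega> in M. (\<Sum>j\<in>{1..2}. P (T j) \<omega>) = 1"
  proof (rule P_partition)
    show "disjoint_family_on T {1..2}"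
      by (simp add: disjoint_family_on_def atLeast T_def; blast)
    show "(\<Union>j\<in>{1..2}. T j) = UNIV"
      by (simp add: atLeast T_def; blast)
    show "T ` {1..2} \<subseteq> sets borel"
      using assms(1,2) by (simp add: atLeast T_def)
  qed simp
  ultimately show ?thesis
    by eventually_elim (simp add: atLeast S_def T_def)
qed

lemma P_empty: "AE \<omega> in M. P {} \<omega> = 0"
proof -
  have "AE \<omega> in M. P ({} \<union> {}) \<omega> = P {} \<omega> + P {} \<omega>"
    by (rule P_Un) auto
  then show ?thesis by simp
qed

lemma P_Diff:
  assumes "A \<in> sets borel" "B \<in> sets borel" "A \<subseteq> B"
  shows "AE \<omega> in M. P (B - A) \<omega> = P B \<omega> - P A \<omega>"
proof -
  have "A \<union> (B - A) = B" using assms by blast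
  moreover have "AE \<omega> in M. P (A \<union> (B - A)) \<omega> = P A \<omega> + P (B - A) \<omega>"
    using assms by (intro P_Un) auto
  ultimately have "AE \<omega> in M. P B \<omega> = P A \<omega> + P (B - A) \<omega>" by simp
  then show ?thesis by eventually_elim simp
qed

lemma P_mono:
  assumes "A \<in> sets borel" "B \<in> sets borel" "A \<subseteq> B"
  shows "AE \<omega> in M. P A \<omega> \<le> P B \<omega>"
  using P_Diff[OF assms] AE_space
proof eventually_elim
  case (elim \<omega>)
  moreover have "0 \<le> P (B - A) \<omega>"
    using P_range[of "B - A" \<omega>] assms elim by blast
  ultimately show ?case by linarith
qed

lemma P_Un_Int:
  assumes "A \<in> sets borel" "B \<in> sets borel"
  shows "AE \<omega> in M. P (A \<union> B) \<omega> = P A \<omega> + P B \<omega> - P (A \<inter> B) \<omega>"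
proof -
  have "AE \<omega> in M. P (A \<union> (B - A \<inter> B)) \<omega> = P A \<omega> + P (B - A \<inter> B) \<omega>"
    using assms by (intro P_Un) auto
  moreover have "A \<union> (B - A \<inter> B) = A \<union> B" by auto
  moreover have "AE \<omega> in M. P (B - A \<inter> B) \<omega> = P B \<omega> - P (A \<inter> B) \<omega>"
    using assms by (intro P_Diff) auto
  ultimately show ?thesis
    by (simp only:) (elim AE_mp, intro AE_I2, simp)
qed

lemma P_UN_sum:
  fixes A :: "nat \<Rightarrow> 'x set"
  assumes "\<And>i. A i \<in> sets borel" "disjoint_family A"
  shows "AE \<omega> in M. P (\<Union>i<n. A i) \<omega> = (\<Sum>i<n. P (A i) \<omega>)"
proof (induction n)
  case 0
  then show ?case using P_empty by simp
next
  case (Suc n)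
  have "AE \<omega> in M. P ((\<Union>i<n. A i) \<union> A n) \<omega> = P (\<Union>i<n. A i) \<omega> + P (A n) \<omega>"
  proof (rule P_Un)
    have "A i \<inter> A n = {}" if "i < n" for i
      using assms(2) that by (auto simp: disjoint_family_on_def)
    then show "(\<Union>i<n. A i) \<inter> A n = {}" by blast
  qed (use assms in auto)
  with Suc show ?case
    by eventually_elim (simp add: lessThan_Suc Un_commute)
qed

text \<open>Finite additivity together with continuity at the empty set, applied to the tails
  \<open>?R n\<close>. The null set depends on the sequence \<open>A\<close>.\<close>

lemma P_sums:
  fixes A :: "nat \<Rightarrow> 'x set"
  assumes "\<And>i. A i \<in> sets borel" "disjoint_family A"
  shows "AE \<omega> in M. (\<lambda>i. P (A i) \<omega>) sums P (\<Union>i. A i) \<omega>"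
proof -
  let ?R = "\<lambda>n. (\<Union>i. A i) - (\<Union>i<n. A i)"
  have "AE \<omega> in M. (\<lambda>n. P (?R n) \<omega>) \<longlonglongrightarrow> 0"
  proof (rule P_decseq)
    show "range ?R \<subseteq> sets borel" using assms by auto
    show "decseq ?R" by (force simp: decseq_def)
    show "(\<Inter>n. ?R n) = {}" by auto
  qed
  moreover have "AE \<omega> in M. \<forall>n. P (?R n) \<omega> = P (\<Union>i. A i) \<omega> - P (\<Union>i<n. A i) \<omega>"
    unfolding AE_all_countable using assms by (intro allI P_Diff) auto
  moreover have "AE \<omega> in M. \<forall>n. P (\<Union>i<n. A i) \<omega> = (\<Sum>i<n. P (A i) \<omega>)"
    unfolding AE_all_countable using assms by (intro allI P_UN_sum)
  ultimately show ?thesis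
  proof eventually_elim
    case (elim \<omega>)
    then have "(\<lambda>n. P (\<Union>i. A i) \<omega> - (P (\<Union>i. A i) \<omega> - (\<Sum>i<n. P (A i) \<omega>))) \<longlonglongrightarrow> P (\<Union>i. A i) \<omega> - 0"
      by (intro tendsto_intros) simp
    then show ?case by (simp add: sums_def)
  qed
qed

text \<open>Used with \<open>T = B\<close>, \<open>c = 1\<close> inside and with
  \<open>T = - B\<close>, \<open>c = 1 / (1 - P B)\<close> outside. Outside \<open>B\<close> it is
  the relative mass that generators of the outer field describe, so the Dynkin argument has to carry
  the factor \<open>c\<close> along.\<close>

lemma P_Int_measurable_generated:
  assumes G: "subalgebra M G"
    and \<A>: "\<And>A B. A \<in> \<A> \<Longrightarrow> B \<in> \<A> \<Longrightarrow> A \<inter> B \<in> \<A>" "UNIV \<in> \<A>" "sigma_sets UNIV \<A> = sets borel"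
    and T: "T \<in> sets borel" and c: "c \<in> borel_measurable M"
    and base: "\<And>A. A \<in> \<A> \<Longrightarrow> (\<lambda>\<omega>. P (A \<inter> T) \<omega> * c \<omega>) \<in> borel_measurable (augment M G)"
    and A: "A \<in> sets borel"
  shows "(\<lambda>\<omega>. P (A \<inter> T) \<omega> * c \<omega>) \<in> borel_measurable (augment M G)"
proof -
  have \<A>': "Int_stable \<A>" "\<A> \<subseteq> Pow UNIV"
    using \<A>(1) by (blast intro: Int_stableI)+
  have meas: "(\<lambda>\<omega>. P (A \<inter> T) \<omega> * c \<omega>) \<in> borel_measurable M" if "A \<in> sets borel" for A
    using that T c by (intro borel_measurable_times P_measurable) auto
  have "A \<in> sigma_sets UNIV \<A>"
    using A \<A>(3) by simp
  with \<A>' show ?thesis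
  proof (induction rule: sigma_sets_induct_disjoint)
    case (basic A)
    then show ?case by (rule base)
  next
    case empty
    have "AE \<omega> in M. 0 = P ({} \<inter> T) \<omega> * c \<omega>"
      using P_empty by eventually_elim simp
    then show ?case
      by (intro measurable_augment_cong_AE[OF G _ meas, of "\<lambda>_. 0"]) auto
  next
    case (compl A)
    have A: "A \<in> sets borel" using compl(1) \<A>(3) by simp
    have TA: "(UNIV - A) \<inter> T = T - A \<inter> T"
      by auto
    have "AE \<omega> in M. P ((UNIV - A) \<inter> T) \<omega> = P T \<omega> - P (A \<inter> T) \<omega>"
      unfolding TA using A T by (intro P_Diff) auto
    then have "AE \<omega> in M. P (UNIV \<inter> T) \<omega> * c \<omega> - P (A \<inter> T) \<omega> * c \<omega> = P ((UNIV - A) \<inter> T) \<omega> * c \<omega>"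
      by eventually_elim (simp add: left_diff_distrib)
    then show ?case
      using A base[OF \<A>(2)] compl(2)
      by (intro measurable_augment_cong_AE[OF G _ meas, OF borel_measurable_diff]) auto
  next
    case (union A)
    have A: "A i \<in> sets borel" for i
      using union(2) \<A>(3) by auto
    have "AE \<omega> in M. (\<lambda>i. P (A i \<inter> T) \<omega>) sums P (\<Union>i. A i \<inter> T) \<omega>"
      using A T union(1) by (intro P_sums) (auto simp: disjoint_family_on_def)
    then have "AE \<omega> in M. (\<lambda>n. \<Sum>i<n. P (A i \<inter> T) \<omega> * c \<omega>) \<longlonglongrightarrow> P ((\<Union>i. A i) \<inter> T) \<omega> * c \<omega>"
      by eventually_elim (auto simp: sums_def simp flip: sum_distrib_right intro!: tendsto_mult)
    then show ?case
      using A union(3)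
      by (intro measurable_augment_lim[OF G _ meas, of "\<lambda>n \<omega>. \<Sum>i<n. P (A i \<inter> T) \<omega> * c \<omega>"]) auto
  qed
qed

section \<open>Relative increments along a chain\<close>

lemma rel_incr_measurable:
  assumes [measurable]: "A \<in> sets borel" "B \<in> sets borel"
  shows "rel_incr P A B \<in> borel_measurable M"
  unfolding rel_incr_def by measurable

text \<open>Masses are relative increments of chains starting at the empty set, so
  \<open>rel_incr_chain_measurable\<close> can serve both inside and outside
  \<open>B\<close>.\<close>

lemma rel_incr_empty:
  assumes "A \<in> sets borel"
  shows "AE \<omega> in M. rel_incr P {} A \<omega> = P A \<omega>"
  using P_empty by eventually_elim (simp add: rel_incr_def)

text \<open>The formula is the product rule for survival ratios: \<open>1 - rel_incr P A C\<close>
  is the product of \<open>1 - rel_incr P A B\<close> and \<open>1 - rel_incr P B C\<close>.\<close>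

lemma rel_incr_trans:
  assumes borel: "A \<in> sets borel" "B \<in> sets borel" "C \<in> sets borel" and sub: "A \<subseteq> B" "B \<subseteq> C"
    and lt: "AE \<omega> in M. P A \<omega> < 1"
  shows "AE \<omega> in M. rel_incr P A C \<omega> =
    rel_incr P A B \<omega> + rel_incr P B C \<omega> * (1 - rel_incr P A B \<omega>)"
  using P_mono[OF borel(2,3) sub(2)] lt AE_space
proof eventually_elim
  case (elim \<omega>)
  have le: "P B \<omega> \<le> 1" "P C \<omega> \<le> 1"
    using P_range borel elim by auto
  show ?case
  proof (cases "P B \<omega> < 1")
    case True
    have "1 - (P B \<omega> - P A \<omega>) / (1 - P A \<omega>) = (1 - P B \<omega>) / (1 - P A \<omega>)"
      using elim by (simp add: divide_simps)
    then have "(P C \<omega> - P B \<omega>) / (1 - P B \<omega>) * (1 - (P B \<omega> - P A \<omega>) / (1 - P A \<omega>)) =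
        (P C \<omega> - P B \<omega>) / (1 - P A \<omega>)"
      using True by simp
    then show ?thesis
      using elim True by (simp add: rel_incr_def flip: add_divide_distrib)
  next
    \<comment> \<open>Here \<open>rel_incr P A B\<close> is 1, so the default value of
      \<open>rel_incr P B C\<close> is multiplied by zero.\<close>
    case False
    then have "P B \<omega> = 1" "P C \<omega> = 1"
      using le elim by auto
    then show ?thesis
      using elim by (simp add: rel_incr_def)
  qed
qed

text \<open>The product rule recovers \<open>rel_incr P (C 0) (C i)\<close> from the successive
  increments. Differences of consecutive values are the relative masses of the steps of the chain,
  and summing over the steps contained in \<open>F\<close> gives its relative increment.\<close>

lemma rel_incr_chain_measurable:
  assumes G: "subalgebra M G" and C: "\<And>i. C i \<in> sets borel" "mono C"
    and lt: "AE \<omega> in M. P (C 0) \<omega> < 1"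
    and incr: "\<And>i. i < N \<Longrightarrow> rel_incr P (C i) (C (Suc i)) \<in> borel_measurable (augment M G)"
    and F: "F \<in> sets borel" "C 0 \<subseteq> F" and refines: "refines C N F"
  shows "rel_incr P (C 0) F \<in> borel_measurable (augment M G)"
proof -
  have V: "rel_incr P (C 0) (C i) \<in> borel_measurable (augment M G)" if "i \<le> N" for i
    using that
  proof (induction i)
    case 0
    have "AE \<omega> in M. 0 = rel_incr P (C 0) (C 0) \<omega>"
      using lt by eventually_elim (simp add: rel_incr_def)
    then show ?case
      by (intro measurable_augment_cong_AE[OF G _ rel_incr_measurable[OF C(1) C(1)], of "\<lambda>_. 0"]) auto
  next
    case (Suc i)
    let ?u = "\<lambda>\<omega>. rel_incr P (C 0) (C i) \<omega> +
      rel_incr P (C i) (C (Suc i)) \<omega> * (1 - rel_incr P (C 0) (C i) \<omega>)"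
    have "C 0 \<subseteq> C i" "C i \<subseteq> C (Suc i)"
      using C(2) by (auto simp: monoD)
    from rel_incr_trans[OF C(1) C(1) C(1) this lt]
    have "AE \<omega> in M. ?u \<omega> = rel_incr P (C 0) (C (Suc i)) \<omega>"
      by eventually_elim simp
    moreover have "?u \<in> borel_measurable (augment M G)"
      using Suc incr[of i] by (intro borel_measurable_add borel_measurable_times borel_measurable_diff) auto
    ultimately show ?case
      by (intro measurable_augment_cong_AE[OF G _ rel_incr_measurable[OF C(1) C(1)], of ?u])
  qed
  \<comment> \<open>By \<open>refines\<close>, each \<open>W i\<close> with \<open>i < N\<close> is
    either the whole step or empty.\<close>
  define W where "W i = F \<inter> (C (Suc i) - C i)" for i
  have part: "AE \<omega> in M. P (F \<inter> C n) \<omega> = P (C 0) \<omega> + (\<Sum>i<n. P (W i) \<omega>)" for n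
  proof (induction n)
    case 0
    then show ?case using F(2) by (simp add: Int_absorb1)
  next
    case (Suc n)
    have "C n \<subseteq> C (Suc n)" using C(2) by (simp add: monoD)
    then have "F \<inter> C (Suc n) = (F \<inter> C n) \<union> W n"
      by (auto simp: W_def)
    moreover have "AE \<omega> in M. P ((F \<inter> C n) \<union> W n) \<omega> = P (F \<inter> C n) \<omega> + P (W n) \<omega>"
      using C(1) F(1) by (intro P_Un) (auto simp: W_def)
    ultimately have "AE \<omega> in M. P (F \<inter> C (Suc n)) \<omega> = P (F \<inter> C n) \<omega> + P (W n) \<omega>" by simp
    with Suc show ?case by eventually_elim simp
  qed
  let ?v = "\<lambda>i \<omega>. if C (Suc i) - C i \<subseteq> F
      then rel_incr P (C 0) (C (Suc i)) \<omega> - rel_incr P (C 0) (C i) \<omega> else 0"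
  have "AE \<omega> in M. \<forall>i\<in>{..<N}. P (W i) \<omega> / (1 - P (C 0) \<omega>) = ?v i \<omega>"
  proof (subst AE_finite_all, simp, intro ballI)
    fix i assume i: "i \<in> {..<N}"
    show "AE \<omega> in M. P (W i) \<omega> / (1 - P (C 0) \<omega>) = ?v i \<omega>"
    proof (cases "C (Suc i) - C i \<subseteq> F")
      case True
      then have "W i = C (Suc i) - C i" by (auto simp: W_def)
      moreover have "AE \<omega> in M. P (C (Suc i) - C i) \<omega> = P (C (Suc i)) \<omega> - P (C i) \<omega>"
        using C by (intro P_Diff) (auto simp: monoD)
      ultimately have "AE \<omega> in M. P (W i) \<omega> = P (C (Suc i)) \<omega> - P (C i) \<omega>" by simp
      with lt show ?thesis
        by eventually_elim (use True in \<open>simp add: rel_incr_def flip: diff_divide_distrib\<close>)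
    next
      case False
      then have "W i = {}" using refines i by (auto simp: W_def refines_def)
      with False show ?thesis
        using P_empty by (auto elim: eventually_mono)
    qed
  qed
  with part[of N] lt have "AE \<omega> in M. (\<Sum>i<N. ?v i \<omega>) = rel_incr P (C 0) F \<omega>"
  proof eventually_elim
    case (elim \<omega>)
    have "(\<Sum>i<N. ?v i \<omega>) = (\<Sum>i<N. P (W i) \<omega>) / (1 - P (C 0) \<omega>)"
      using elim by (simp add: sum_divide_distrib)
    then show ?case
      using elim refines by (simp add: rel_incr_def refines_def Int_absorb2)
  qed
  moreover have "(\<lambda>\<omega>. \<Sum>i<N. ?v i \<omega>) \<in> borel_measurable (augment M G)"
  proof (rule borel_measurable_sum)
    fix i assume "i \<in> {..<N}"
    then show "?v i \<in> borel_measurable (augment M G)"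
      using V[of i] V[of "Suc i"] by (cases "C (Suc i) - C i \<subseteq> F") auto
  qed
  ultimately show ?thesis
    by (intro measurable_augment_cong_AE[OF G _ rel_incr_measurable[OF C(1) F(1)]])
qed

end

section \<open>Neutrality to the right\<close>

lemma finite_unionsI: "A \<in> \<A> \<Longrightarrow> A \<in> finite_unions \<A>"
  by (auto simp: finite_unions_def intro!: exI[of _ "{A}"])

lemma finite_unions_Un:
  assumes "A \<in> finite_unions \<A>" "B \<in> finite_unions \<A>"
  shows "A \<union> B \<in> finite_unions \<A>"
proof -
  obtain S T where "finite S" "S \<subseteq> \<A>" "A = \<Union>S" "finite T" "T \<subseteq> \<A>" "B = \<Union>T"
    using assms unfolding finite_unions_def by blast
  then show ?thesis
    by (auto simp: finite_unions_def intro!: exI[of _ "S \<union> T"])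
qed

lemma finite_unions_Int:
  assumes "A \<in> finite_unions \<A>" "B \<in> finite_unions \<A>"
    and Int: "\<And>A B. A \<in> \<A> \<Longrightarrow> B \<in> \<A> \<Longrightarrow> A \<inter> B \<in> \<A>"
  shows "A \<inter> B \<in> finite_unions \<A>"
proof -
  obtain S T where *: "finite S" "S \<subseteq> \<A>" "A = \<Union>S" "finite T" "T \<subseteq> \<A>" "B = \<Union>T"
    using assms(1,2) unfolding finite_unions_def by blast
  let ?U = "(\<lambda>(s, t). s \<inter> t) ` (S \<times> T)"
  have "finite ?U" "A \<inter> B = \<Union>?U"
    using * by auto
  moreover have "?U \<subseteq> \<A>"
    using * by (auto intro!: Int)
  ultimately show ?thesis
    unfolding finite_unions_def by blast
qed

locale neutral_random_measure = random_measure M P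
  for M :: "'w measure" and P :: "'x::t2_space set \<Rightarrow> 'w \<Rightarrow> real" +
  fixes \<A> :: "'x set set"
  assumes indexing: "indexing_collection \<A>" and neutral: "neutral_to_the_right M \<A> P"
begin

lemma indexing_borel: "A \<in> \<A> \<Longrightarrow> A \<in> sets borel"
  and indexing_generates: "sigma_sets UNIV \<A> = sets borel"
  and indexing_empty: "{} \<in> \<A>"
  and indexing_UNIV: "UNIV \<in> \<A>"
  and indexing_Int: "A \<in> \<A> \<Longrightarrow> B \<in> \<A> \<Longrightarrow> A \<inter> B \<in> \<A>"
proof -
  from indexing[unfolded indexing_collection_def]
  have closed: "\<forall>A\<in>\<A>. closed A"
    and rest: "sigma_sets UNIV \<A> = sets borel" "{} \<in> \<A>" "UNIV \<in> \<A>"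
    and Inter: "\<forall>S. S \<subseteq> \<A> \<longrightarrow> \<Inter>S \<in> \<A>"
    by - (elim conjE, assumption)+
  show "sigma_sets UNIV \<A> = sets borel" "{} \<in> \<A>" "UNIV \<in> \<A>"
    by (fact rest)+
  show "A \<in> sets borel" if "A \<in> \<A>"
    using closed that by (intro borel_closed) simp
  show "A \<inter> B \<in> \<A>" if "A \<in> \<A>" "B \<in> \<A>"
    using Inter[rule_format, of "{A, B}"] that by simp
qed

lemma finite_unions_borel: "A \<in> finite_unions \<A> \<Longrightarrow> A \<in> sets borel"
  by (auto simp: finite_unions_def intro!: sets.finite_Union intro: indexing_borel)

lemma neutral_indep_sets:
  fixes k :: nat
  assumes "1 \<le> k" "\<And>i. i \<in> {1..k} \<Longrightarrow> B i \<in> finite_unions \<A>" "\<And>i. i \<in> {1..<k} \<Longrightarrow> B i \<subseteq> B (i + 1)"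
  shows "indep_sets (\<lambda>i. {(if i = 1 then P (B 1) else rel_incr P (B (i - 1)) (B i)) -` S \<inter> space M | S.
    S \<in> sets borel}) {1..k}"
proof -
  have "indep_vars (\<lambda>_. borel) (\<lambda>i. if i = 1 then P (B 1) else rel_incr P (B (i - 1)) (B i)) {1..k}"
    by (rule neutral[unfolded neutral_to_the_right_def, rule_format]) (use assms in auto)
  then show ?thesis
    by (simp add: indep_vars_def2)
qed

lemma rel_incr_blocks_indep:
  assumes E: "\<And>i. E i \<in> finite_unions \<A>" "mono E" and "n \<le> m"
  defines "V \<equiv> \<lambda>i. rel_incr P (E i) (E (Suc i))"
  shows "indep_set (sets (gen_sigma M borel {..<n} V)) (sets (gen_sigma M borel {n..<m} V))"
proof -
  let ?B = "\<lambda>i. E (i - 1)"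
  let ?F = "\<lambda>i. {(if i = 1 then P (?B 1) else rel_incr P (?B (i - 1)) (?B i)) -` S \<inter> space M | S.
    S \<in> sets borel}"
  \<comment> \<open>Neutrality numbers its variables from 1, and the first is the mass of
    \<open>E 0\<close> rather than an increment; hence \<open>V i\<close> carries the number
    \<open>i + 2\<close>.\<close>
  let ?I = "\<lambda>b. (\<lambda>i. i + 2) ` (if b then {..<n} else {n..<m})"
  have "indep_sets ?F {1..m + 1}"
    using E by (intro neutral_indep_sets) (auto simp: mono_def)
  then have "indep_sets ?F (\<Union>b\<in>UNIV. ?I b)"
    by (rule indep_sets_mono_index[rotated]) (use assms(3) in \<open>auto split: if_splits\<close>)
  then have "indep_sets (\<lambda>b. sigma_sets (space M) (\<Union>i\<in>?I b. ?F i)) UNIV"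
  proof (rule indep_sets_collect_sigma)
    fix i b
    show "Int_stable (?F i)"
    proof (rule Int_stableI)
      fix a b assume "a \<in> ?F i" "b \<in> ?F i"
      then obtain S T where "S \<in> sets borel" "T \<in> sets borel"
        "a = (if i = 1 then P (?B 1) else rel_incr P (?B (i - 1)) (?B i)) -` S \<inter> space M"
        "b = (if i = 1 then P (?B 1) else rel_incr P (?B (i - 1)) (?B i)) -` T \<inter> space M"
        by blast
      then show "a \<inter> b \<in> ?F i"
        by (intro CollectI exI[of _ "S \<inter> T"]) auto
    qed
    show "disjoint_family_on ?I UNIV"
      by (auto simp: disjoint_family_on_def)
  qed
  moreover have "(\<lambda>b. sigma_sets (space M) (\<Union>i\<in>?I b. ?F i)) =
      case_bool (sets (gen_sigma M borel {..<n} V)) (sets (gen_sigma M borel {n..<m} V))"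
  proof
    fix b
    have "(\<Union>i\<in>(\<lambda>i. i + 2) ` K. ?F i) = {V i -` S \<inter> space M |i S. i \<in> K \<and> S \<in> sets borel}" for K
      by (auto simp: V_def)
    then show "sigma_sets (space M) (\<Union>i\<in>?I b. ?F i) =
      (case b of True \<Rightarrow> sets (gen_sigma M borel {..<n} V) | False \<Rightarrow> sets (gen_sigma M borel {n..<m} V))"
      unfolding sets_gen_sigma by (cases b) simp_all
  qed
  ultimately show ?thesis
    unfolding indep_set_def by simp
qed

text \<open>\<open>V\<close> between \<open>B\<close> and \<open>B\<close> is the indicator of \<open>P B = 1\<close>, so neutrality makes this event
  independent of itself.\<close>

lemma P_eq_1_trivial:
  assumes B: "B \<in> finite_unions \<A>"
  shows "(AE \<omega> in M. P B \<omega> < 1) \<or> (AE \<omega> in M. P B \<omega> = 1)"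
proof -
  note [measurable] = finite_unions_borel[OF B]
  let ?e = "P B -` {1} \<inter> space M"
  let ?Y = "\<lambda>i::nat. if i = 1 then P B else rel_incr P B B"
  have "indep_sets (\<lambda>i. {?Y i -` S \<inter> space M | S. S \<in> sets borel}) {1..2}"
    using B by (intro neutral_indep_sets) auto
  moreover have "?Y i -` {1} \<inter> space M = ?e" for i
  proof -
    have "rel_incr P B B \<omega> = 1 \<longleftrightarrow> P B \<omega> = 1" if "\<omega> \<in> space M" for \<omega>
      using P_range[OF finite_unions_borel[OF B] that] by (auto simp: rel_incr_def)
    then show ?thesis by auto
  qed
  then have "?e \<in> {?Y i -` S \<inter> space M | S. S \<in> sets borel}" for i
    by (intro CollectI exI[of _ "{1}"]) simp
  ultimately have "prob (\<Inter>i\<in>{1..2::nat}. ?e) = (\<Prod>i\<in>{1..2::nat}. prob ?e)"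
    by (intro indep_setsD) auto
  then have "prob ?e = prob ?e * prob ?e"
    by (simp add: numeral_2_eq_2)
  then have "prob ?e = 0 \<or> prob ?e = 1" by simp
  moreover have e: "?e \<in> events"
    by measurable
  ultimately show ?thesis
  proof (elim disjE)
    assume "prob ?e = 0"
    then have "?e \<in> null_sets M" using e by (auto simp: null_sets_def emeasure_eq_measure)
    then have "AE \<omega> in M. \<omega> \<notin> ?e" by (rule AE_not_in)
    then have "AE \<omega> in M. P B \<omega> < 1"
      using AE_space
    proof eventually_elim
      case (elim \<omega>)
      then show ?case using P_range[OF finite_unions_borel[OF B], of \<omega>] by auto
    qed
    then show ?thesis ..
  next
    assume "prob ?e = 1"
    then have "AE \<omega> in M. \<omega> \<in> ?e" using AE_in_set_eq_1[OF e] by blast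
    then have "AE \<omega> in M. P B \<omega> = 1" by eventually_elim simp
    then show ?thesis ..
  qed
qed

section \<open>The fields inside and outside \<open>B\<close>\<close>

definition F_right :: "'x set \<Rightarrow> 'w measure" where
  "F_right B = gen_sigma M borel {D \<in> finite_unions \<A>. B \<subseteq> D} (rel_incr P B)"

lemma subalgebra_F_sigma: "subalgebra M (F_sigma M \<A> P B)"
  unfolding F_sigma_def by (intro subalgebra_gen_sigma P_measurable) (auto intro: indexing_borel)

lemma subalgebra_F_right: "B \<in> finite_unions \<A> \<Longrightarrow> subalgebra M (F_right B)"
  unfolding F_right_def
  by (intro subalgebra_gen_sigma rel_incr_measurable) (auto intro: finite_unions_borel)

text \<open>For finitely many generators on each side, a refining chain from the empty set inside
  \<open>B\<close> followed by one starting at \<open>B\<close> is a single chain in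
  \<open>\<A>(u)\<close>. Its increments are independent by neutrality, and the generators are
  recovered from the two blocks up to null sets.\<close>

lemma F_sigma_indep_F_right:
  assumes B: "B \<in> finite_unions \<A>" and lt: "AE \<omega> in M. P B \<omega> < 1"
  shows "indep_set (sets (F_sigma M \<A> P B)) (sets (F_right B))"
  unfolding F_sigma_def F_right_def
proof (rule indep_set_gen_sigma_finite2)
  fix J J' assume J: "finite J" "J \<subseteq> {A \<in> \<A>. A \<subseteq> B}"
    and J': "finite J'" "J' \<subseteq> {D \<in> finite_unions \<A>. B \<subseteq> D}"
  note fu = finite_unions_Un[of _ \<A>] finite_unions_Int[OF _ _ indexing_Int] finite_unionsI
  have "\<exists>C N. C 0 = {} \<and> range C \<subseteq> {D \<in> finite_unions \<A>. D \<subseteq> B} \<and> mono C \<and> (\<forall>F\<in>J. refines C N F)"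
  proof (rule refining_chain)
    show "J \<subseteq> {D \<in> finite_unions \<A>. D \<subseteq> B}" using J(2) fu(3) by blast
    show "{} \<in> {D \<in> finite_unions \<A>. D \<subseteq> B}" using fu(3)[OF indexing_empty] by simp
    show "A \<inter> A' \<in> {D \<in> finite_unions \<A>. D \<subseteq> B}"
      if "A \<in> {D \<in> finite_unions \<A>. D \<subseteq> B}" "A' \<in> {D \<in> finite_unions \<A>. D \<subseteq> B}" for A A'
      using that by (simp add: fu le_infI1)
    show "A \<union> A' \<in> {D \<in> finite_unions \<A>. D \<subseteq> B}"
      if "A \<in> {D \<in> finite_unions \<A>. D \<subseteq> B}" "A' \<in> {D \<in> finite_unions \<A>. D \<subseteq> B}" for A A'
      using that by (simp add: fu)
  qed (simp_all add: J(1))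
  then obtain C N where C: "C 0 = {}" "range C \<subseteq> {D \<in> finite_unions \<A>. D \<subseteq> B}" "mono C"
    "\<forall>F\<in>J. refines C N F" by (elim exE conjE)
  have CB: "C i \<in> finite_unions \<A>" "C i \<subseteq> B" for i using C(2) by blast+
  have "\<exists>D N'. D 0 = B \<and> range D \<subseteq> {D \<in> finite_unions \<A>. B \<subseteq> D} \<and> mono D \<and> (\<forall>F\<in>J'. refines D N' F)"
  proof (rule refining_chain)
    show "A \<inter> A' \<in> {D \<in> finite_unions \<A>. B \<subseteq> D}"
      if "A \<in> {D \<in> finite_unions \<A>. B \<subseteq> D}" "A' \<in> {D \<in> finite_unions \<A>. B \<subseteq> D}" for A A'
      using that by (simp add: fu)
    show "A \<union> A' \<in> {D \<in> finite_unions \<A>. B \<subseteq> D}"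
      if "A \<in> {D \<in> finite_unions \<A>. B \<subseteq> D}" "A' \<in> {D \<in> finite_unions \<A>. B \<subseteq> D}" for A A'
      using that by (simp add: fu le_supI1)
  qed (use J' B in simp_all)
  then obtain D N' where D: "D 0 = B" "range D \<subseteq> {D \<in> finite_unions \<A>. B \<subseteq> D}" "mono D"
    "\<forall>F\<in>J'. refines D N' F" by (elim exE conjE)
  have DB: "D i \<in> finite_unions \<A>" "B \<subseteq> D i" for i using D(2) by blast+
  \<comment> \<open>The link from \<open>C N\<close> to \<open>D 0 = B\<close> is the increment
    \<open>V N\<close>. It lies inside \<open>B\<close> and is put into the first block, which
    therefore ends at \<open>Suc N\<close>.\<close>
  define E where "E i = (if i \<le> N then C i else D (i - Suc N))" for i
  define V where "V i = rel_incr P (E i) (E (Suc i))" for i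
  let ?G = "gen_sigma M borel {..<Suc N} V" and ?H = "gen_sigma M borel {Suc N..<Suc N + N'} V"
  have E: "E i \<in> finite_unions \<A>" for i
    using CB(1) DB(1) by (simp add: E_def)
  have "mono E"
  proof (rule monoI)
    fix i j :: nat assume ij: "i \<le> j"
    have "C i \<subseteq> C j" "D (i - Suc N) \<subseteq> D (j - Suc N)"
      using ij by (auto intro!: monoD[OF C(3)] monoD[OF D(3)])
    moreover have "C i \<subseteq> D (j - Suc N)" using CB(2) DB(2) by blast
    ultimately show "E i \<subseteq> E j" using ij by (simp add: E_def)
  qed
  then have "indep_set (sets ?G) (sets ?H)"
    unfolding V_def using E by (intro rel_incr_blocks_indep) auto
  moreover have mV: "V i \<in> borel_measurable M" for i
    unfolding V_def using E finite_unions_borel by (intro rel_incr_measurable) blast+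
  then have G: "subalgebra M ?G" and H: "subalgebra M ?H"
    by (auto intro: subalgebra_gen_sigma)
  ultimately have indep: "indep_set (sets (augment M ?G)) (sets (augment M ?H))"
    by (intro indep_set_augment)
  have "P F \<in> borel_measurable (augment M ?G)" if F: "F \<in> J" for F
  proof -
    have Fb: "F \<in> sets borel" using F J indexing_borel by blast
    have "rel_incr P (C 0) F \<in> borel_measurable (augment M ?G)"
    proof (rule rel_incr_chain_measurable[OF G _ C(3) _ _ Fb _ bspec[OF C(4) F]])
      show "C i \<in> sets borel" for i using CB(1) by (rule finite_unions_borel)
      show "AE \<omega> in M. P (C 0) \<omega> < 1"
        unfolding C(1) using P_empty by eventually_elim simp
      show "C 0 \<subseteq> F" by (simp add: C(1))
      fix i assume "i < N"
      then have i: "i \<in> {..<Suc N}" and Vi: "V i = rel_incr P (C i) (C (Suc i))"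
        by (simp_all add: V_def E_def)
      show "rel_incr P (C i) (C (Suc i)) \<in> borel_measurable (augment M ?G)"
        unfolding Vi[symmetric] by (rule measurable_augmentI[OF G measurable_gen_sigma[OF i mV]])
    qed
    then show ?thesis
      unfolding C(1)
      by (rule measurable_augment_cong_AE[OF G _ P_measurable[OF Fb] rel_incr_empty[OF Fb]])
  qed
  then have 1: "sets (gen_sigma M borel J P) \<subseteq> sets (augment M ?G)"
    by (intro gen_sigma_least) simp_all
  have "rel_incr P B F \<in> borel_measurable (augment M ?H)" if F: "F \<in> J'" for F
    unfolding D(1)[symmetric]
  proof (rule rel_incr_chain_measurable[OF H _ D(3) _ _ _ _ bspec[OF D(4) F]])
    show "F \<in> sets borel" using F J' finite_unions_borel by blast
    show "D i \<in> sets borel" for i using DB(1) by (rule finite_unions_borel)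
    show "AE \<omega> in M. P (D 0) \<omega> < 1" using lt by (simp add: D(1))
    show "D 0 \<subseteq> F" using F J' D(1) by blast
    fix i assume "i < N'"
    then have i: "Suc N + i \<in> {Suc N..<Suc N + N'}"
      and Vi: "V (Suc N + i) = rel_incr P (D i) (D (Suc i))"
      by (simp_all add: V_def E_def)
    show "rel_incr P (D i) (D (Suc i)) \<in> borel_measurable (augment M ?H)"
      unfolding Vi[symmetric] by (rule measurable_augmentI[OF H measurable_gen_sigma[OF i mV]])
  qed
  then have 2: "sets (gen_sigma M borel J' (rel_incr P B)) \<subseteq> sets (augment M ?H)"
    by (intro gen_sigma_least) simp_all
  show "indep_set (sets (gen_sigma M borel J P)) (sets (gen_sigma M borel J' (rel_incr P B)))"
    using indep 1 2 by (rule indep_set_mono)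
qed

text \<open>The generators of \<open>F_sigma\<close> are masses of members of \<open>\<A>\<close>,
  but the trace of such a member on \<open>B\<close> is in general only a finite union.
  Inclusion-exclusion closes the gap.\<close>

lemma P_finite_union_measurable:
  assumes "finite \<S>" "\<S> \<subseteq> \<A>" "\<Union>\<S> \<subseteq> B"
  shows "P (\<Union>\<S>) \<in> borel_measurable (augment M (F_sigma M \<A> P B))"
  using assms
proof (induction "card \<S>" arbitrary: \<S> rule: less_induct)
  case less
  let ?G = "F_sigma M \<A> P B"
  have G: "subalgebra M ?G" by (rule subalgebra_F_sigma)
  have single: "P A \<in> borel_measurable (augment M ?G)" if "A \<in> \<A>" "A \<subseteq> B" for A
  proof (rule measurable_augmentI[OF G])
    show "P A \<in> borel_measurable ?G"
      unfolding F_sigma_def using that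
      by (intro measurable_gen_sigma P_measurable indexing_borel) simp_all
  qed
  show ?case
  proof (cases "\<S> = {}")
    case True
    then show ?thesis using single[OF indexing_empty] by simp
  next
    case False
    then obtain A where A: "A \<in> \<S>" by blast
    \<comment> \<open>The sets in \<open>?I\<close> need not belong to \<open>\<S>\<close>. The
      induction therefore runs over the cardinality, which is smaller for both families.\<close>
    let ?T = "\<S> - {A}" and ?I = "(\<lambda>S. A \<inter> S) ` (\<S> - {A})"
    have cardT: "card ?T < card \<S>"
      using less.prems(1) A by (rule card_Diff1_less)
    moreover have "card ?I \<le> card ?T"
      using less.prems(1) by (intro card_image_le) simp
    ultimately have cardI: "card ?I < card \<S>" by simp
    have AA: "A \<in> \<A>" "A \<subseteq> B" using A less.prems by auto
    have T: "P (\<Union>?T) \<in> borel_measurable (augment M ?G)"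
      by (rule less.hyps[OF cardT]) (use less.prems in auto)
    have I: "P (\<Union>?I) \<in> borel_measurable (augment M ?G)"
    proof (rule less.hyps[OF cardI])
      show "?I \<subseteq> \<A>" using AA less.prems(2) by (auto intro!: indexing_Int)
    qed (use less.prems in auto)
    have Tb: "\<Union>?T \<in> sets borel"
      using less.prems by (intro sets.finite_Union) (auto intro: indexing_borel)
    have eq: "A \<union> \<Union>?T = \<Union>\<S>" "A \<inter> \<Union>?T = \<Union>?I" using A by auto
    have "AE \<omega> in M. P (A \<union> \<Union>?T) \<omega> = P A \<omega> + P (\<Union>?T) \<omega> - P (A \<inter> \<Union>?T) \<omega>"
      using Tb indexing_borel[OF AA(1)] by (intro P_Un_Int)
    then have eqAE: "AE \<omega> in M. P A \<omega> + P (\<Union>?T) \<omega> - P (\<Union>?I) \<omega> = P (\<Union>\<S>) \<omega>"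
      unfolding eq by eventually_elim simp
    have meas: "(\<lambda>\<omega>. P A \<omega> + P (\<Union>?T) \<omega> - P (\<Union>?I) \<omega>) \<in> borel_measurable (augment M ?G)"
      by (intro borel_measurable_diff borel_measurable_add single AA T I)
    have "\<Union>\<S> \<in> sets borel"
      unfolding eq(1)[symmetric] using Tb indexing_borel[OF AA(1)] by (rule sets.Un[rotated])
    then show ?thesis
      by (intro measurable_augment_cong_AE[OF G meas _ eqAE] P_measurable)
  qed
qed

lemma P_Int_measurable:
  assumes B: "B \<in> finite_unions \<A>" and A: "A \<in> sets borel"
  shows "P (A \<inter> B) \<in> borel_measurable (augment M (F_sigma M \<A> P B))"
proof -
  have "(\<lambda>\<omega>. P (A \<inter> B) \<omega> * 1) \<in> borel_measurable (augment M (F_sigma M \<A> P B))"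
  proof (rule P_Int_measurable_generated[OF subalgebra_F_sigma indexing_Int indexing_UNIV
        indexing_generates finite_unions_borel[OF B] _ _ A])
    fix A assume "A \<in> \<A>"
    then have "A \<inter> B \<in> finite_unions \<A>"
      by (rule finite_unions_Int[OF finite_unionsI B indexing_Int])
    then obtain \<S> where S: "finite \<S>" "\<S> \<subseteq> \<A>" "\<Union>\<S> = A \<inter> B"
      unfolding finite_unions_def by blast
    show "(\<lambda>\<omega>. P (A \<inter> B) \<omega> * 1) \<in> borel_measurable (augment M (F_sigma M \<A> P B))"
      using P_finite_union_measurable[OF S(1,2), of B] by (simp add: S(3))
  qed simp_all
  then show ?thesis by simp
qed

text \<open>For \<open>A\<close> in \<open>\<A>\<close> the relative mass of \<open>A - B\<close> is
  \<open>rel_incr P B (A \<union> B)\<close>, a generator of \<open>F_right B\<close>; the Dynkin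
  argument does the rest.\<close>

lemma P_Diff_measurable:
  assumes B: "B \<in> finite_unions \<A>" and lt: "AE \<omega> in M. P B \<omega> < 1" and A: "A \<in> sets borel"
  shows "(\<lambda>\<omega>. P (A \<inter> - B) \<omega> * (1 / (1 - P B \<omega>))) \<in> borel_measurable (augment M (F_right B))"
proof (rule P_Int_measurable_generated[OF subalgebra_F_right[OF B] indexing_Int indexing_UNIV
        indexing_generates _ _ _ A])
  note [measurable] = finite_unions_borel[OF B]
  show "- B \<in> sets borel" by simp
  show c: "(\<lambda>\<omega>. 1 / (1 - P B \<omega>)) \<in> borel_measurable M" by measurable
  fix A assume A: "A \<in> \<A>"
  have AB: "A \<union> B \<in> finite_unions \<A>"
    by (rule finite_unions_Un[OF finite_unionsI[OF A] B])
  have "AE \<omega> in M. P (A \<union> B - B) \<omega> = P (A \<union> B) \<omega> - P B \<omega>"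
    using AB B by (intro P_Diff finite_unions_borel) auto
  moreover have "A \<union> B - B = A \<inter> - B" by auto
  ultimately have "AE \<omega> in M. P (A \<inter> - B) \<omega> = P (A \<union> B) \<omega> - P B \<omega>" by simp
  with lt have "AE \<omega> in M. rel_incr P B (A \<union> B) \<omega> = P (A \<inter> - B) \<omega> * (1 / (1 - P B \<omega>))"
    by eventually_elim (simp add: rel_incr_def)
  moreover have "rel_incr P B (A \<union> B) \<in> borel_measurable (augment M (F_right B))"
  proof (rule measurable_augmentI[OF subalgebra_F_right[OF B]])
    show "rel_incr P B (A \<union> B) \<in> borel_measurable (F_right B)"
      unfolding F_right_def using AB B
      by (intro measurable_gen_sigma rel_incr_measurable finite_unions_borel) simp_all
  qed
  moreover have "(\<lambda>\<omega>. P (A \<inter> - B) \<omega> * (1 / (1 - P B \<omega>))) \<in> borel_measurable M"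
    using indexing_borel[OF A] by (intro borel_measurable_times P_measurable c) simp
  ultimately show "(\<lambda>\<omega>. P (A \<inter> - B) \<omega> * (1 / (1 - P B \<omega>))) \<in> borel_measurable (augment M (F_right B))"
    by (rule measurable_augment_cong_AE[OF subalgebra_F_right[OF B], rotated 2])
qed

end

section \<open>Samples\<close>

text \<open>The hypothesis \<open>cross\<close> is the product rule for probabilities given
  \<open>E\<close>, multiplied by the square of \<open>prob E\<close>. In this form unnormalised
  product formulas satisfy it directly.\<close>

lemma (in prob_space) indep_set_uniform_measure:
  assumes E: "E \<in> events" "prob E > 0" and ev: "S \<subseteq> events" "T \<subseteq> events"
    and stable: "Int_stable S" "Int_stable T"
    and cross: "\<And>s t. s \<in> S \<Longrightarrow> t \<in> T \<Longrightarrow>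
      prob (E \<inter> (s \<inter> t)) * prob E = prob (E \<inter> s) * prob (E \<inter> t)"
  shows "prob_space.indep_set (uniform_measure M E) (sigma_sets (space M) S) (sigma_sets (space M) T)"
proof -
  have Epos: "emeasure M E \<noteq> 0" "emeasure M E \<noteq> \<infinity>"
    using E(2) by (auto simp: emeasure_eq_measure)
  interpret Q: prob_space "uniform_measure M E"
    using Epos by (intro prob_space_uniform_measure)
  have "Q.indep_set S T"
  proof (rule Q.indep_setI)
    fix s t assume st: "s \<in> S" "t \<in> T"
    then have "s \<in> events" "t \<in> events" "s \<inter> t \<in> events" using ev by auto
    then show "Q.prob (s \<inter> t) = Q.prob s * Q.prob t"
      using cross[OF st] E(2) Epos by (simp add: field_simps)
  qed (use ev in simp_all)
  then show ?thesis
    using Q.indep_set_sigma_sets[OF _ stable] by simp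
qed

context random_measure
begin

lemma sample_rectangle:
  fixes X :: "nat \<Rightarrow> 'w \<Rightarrow> 'x"
  assumes sample: "sample_from M P n X" and c: "c \<in> sets (gen_sigma M borel (sets borel) P)"
    and A: "\<And>i. A i \<in> sets borel"
  shows "prob (c \<inter> {\<omega>\<in>space M. \<forall>i\<in>{1..n}. X i \<omega> \<in> A i}) =
    expectation (\<lambda>\<omega>. indicator c \<omega> * (\<Prod>i\<in>{1..n}. P (A i) \<omega>))"
proof -
  let ?G = "gen_sigma M borel (sets borel) P"
  let ?R = "{\<omega>\<in>space M. \<forall>i\<in>{1..n}. X i \<omega> \<in> A i}"
  have G: "subalgebra M ?G"
    by (intro subalgebra_gen_sigma P_measurable)
  interpret G: finite_measure_subalgebra M ?G
    using G by (rule finite_measure_subalgebraI)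
  have X: "X i \<in> measurable M borel" if "i \<in> {1..n}" for i
    using conjunct1[OF sample[unfolded sample_from_def]] that by (rule bspec)
  have R: "?R \<in> events"
  proof (rule sets.sets_Collect_finite_All)
    fix i assume "i \<in> {1..n}"
    then have "X i -` A i \<inter> space M \<in> events"
      using A by (intro measurable_sets[OF X])
    moreover have "X i -` A i \<inter> space M = {\<omega> \<in> space M. X i \<omega> \<in> A i}" by auto
    ultimately show "{\<omega> \<in> space M. X i \<omega> \<in> A i} \<in> events" by simp
  qed simp
  have ce: "c \<in> events"
    using c G by (auto simp: subalgebra_def)
  have cond: "AE \<omega> in M. real_cond_exp M ?G (indicator ?R) \<omega> = (\<Prod>i\<in>{1..n}. P (A i) \<omega>)"
    by (rule conjunct2[OF sample[unfolded sample_from_def], rule_format]) (rule A)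
  have "prob (c \<inter> ?R) = (\<integral>\<omega>\<in>c. indicator ?R \<omega> \<partial>M)"
    using R ce by (simp add: set_lebesgue_integral_def flip: indicator_inter_arith)
  also have "\<dots> = (\<integral>\<omega>\<in>c. real_cond_exp M ?G (indicator ?R) \<omega> \<partial>M)"
    using integrable_indicator_events[OF R] c by (rule G.real_cond_exp_intA)
  also have "\<dots> = expectation (\<lambda>\<omega>. indicator c \<omega> * (\<Prod>i\<in>{1..n}. P (A i) \<omega>))"
    unfolding set_lebesgue_integral_def real_scaleR_def
  proof (rule integral_cong_AE)
    show "(\<lambda>\<omega>. indicator c \<omega> * real_cond_exp M ?G (indicator ?R) \<omega>) \<in> borel_measurable M"
      using ce by simp
    show "(\<lambda>\<omega>. indicator c \<omega> * (\<Prod>i\<in>{1..n}. P (A i) \<omega>)) \<in> borel_measurable M"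
      using ce A by (intro borel_measurable_times borel_measurable_prod P_measurable) auto
    show "AE \<omega> in M. indicator c \<omega> * real_cond_exp M ?G (indicator ?R) \<omega> =
        indicator c \<omega> * (\<Prod>i\<in>{1..n}. P (A i) \<omega>)"
      using cond by eventually_elim simp
  qed
  finally show ?thesis .
qed

end

context neutral_random_measure
begin

text \<open>Given \<open>P\<close>, the points of the sample with index in \<open>S\<close> are placed in \<open>B\<close> and the others in \<open>- B\<close>.
  The former contribute masses \<open>P (A \<inter> B)\<close>, the latter \<open>1 - P B\<close> times masses relative to \<open>- B\<close>, and
  the relative masses are independent of everything in \<open>B\<close>.\<close>

lemma sample_rectangle_split:
  fixes X :: "nat \<Rightarrow> 'w \<Rightarrow> 'x"
  assumes sample: "sample_from M P n X"
    and B: "B \<in> finite_unions \<A>" and lt: "AE \<omega> in M. P B \<omega> < 1"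
    and a: "a \<in> sets (F_sigma M \<A> P B)" and b: "b \<in> sets (F_right B)"
    and A: "\<And>i. A i \<in> sets borel" and S: "S \<subseteq> {1..n}"
  shows "prob (a \<inter> b \<inter> {\<omega>\<in>space M. \<forall>i\<in>{1..n}. X i \<omega> \<in> (if i \<in> S then A i \<inter> B else A i \<inter> - B)}) =
    expectation (\<lambda>\<omega>. indicator a \<omega> * (\<Prod>i\<in>S. P (A i \<inter> B) \<omega>) * (1 - P B \<omega>) ^ card ({1..n} - S)) *
    expectation (\<lambda>\<omega>. indicator b \<omega> * (\<Prod>i\<in>{1..n} - S. P (A i \<inter> - B) \<omega> * (1 / (1 - P B \<omega>))))"
    (is "?lhs = expectation ?u * expectation ?v")
proof -
  let ?A = "\<lambda>i. if i \<in> S then A i \<inter> B else A i \<inter> - B"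
  let ?F = "F_sigma M \<A> P B" and ?H = "F_right B" and ?T = "{1..n} - S"
  let ?W = "\<lambda>i \<omega>. P (A i \<inter> - B) \<omega> * (1 / (1 - P B \<omega>))"
  note F = subalgebra_F_sigma[of B] and H = subalgebra_F_right[OF B]
  have Bb: "B \<in> sets borel" using B by (rule finite_unions_borel)
  \<comment> \<open>The mass of \<open>B\<close> is determined inside \<open>B\<close>; this allows
    the powers of \<open>1 - P B\<close> stemming from the outer points to be put into
    \<open>?u\<close>.\<close>
  have P\<^sub>B: "P B \<in> borel_measurable (augment M ?F)"
    using P_Int_measurable[OF B, of UNIV] by simp
  have aF: "a \<in> sets (augment M ?F)" and bH: "b \<in> sets (augment M ?H)"
    using a b sets_augment_superset[OF F] sets_augment_superset[OF H] by auto
  have u: "?u \<in> borel_measurable (augment M ?F)"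
    by (intro borel_measurable_times borel_measurable_indicator borel_measurable_prod
        borel_measurable_power borel_measurable_diff borel_measurable_const aF P\<^sub>B P_Int_measurable[OF B A])
  have v: "?v \<in> borel_measurable (augment M ?H)"
    by (rule borel_measurable_times[OF borel_measurable_indicator[OF bH] borel_measurable_prod])
      (rule P_Diff_measurable[OF B lt A])
  have uM: "?u \<in> borel_measurable M"
    using subalgebra_augment[OF F] u by (rule measurable_from_subalg)
  have vM: "?v \<in> borel_measurable M"
    using subalgebra_augment[OF H] v by (rule measurable_from_subalg)
  \<comment> \<open>The factor \<open>1 / (1 - P B)\<close> alone may be unbounded; the bound on the
    relative masses makes \<open>?v\<close> integrable.\<close>
  have W: "AE \<omega> in M. \<forall>i\<in>?T. 0 \<le> ?W i \<omega> \<and> ?W i \<omega> \<le> 1"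
  proof (subst AE_finite_all, simp, intro ballI)
    fix i assume "i \<in> ?T"
    have "AE \<omega> in M. P (- B) \<omega> = P UNIV \<omega> - P B \<omega>"
      using P_Diff[OF Bb, of UNIV] by (simp add: Compl_eq_Diff_UNIV)
    moreover have "AE \<omega> in M. P (A i \<inter> - B) \<omega> \<le> P (- B) \<omega>"
      using A[of i] Bb by (intro P_mono) auto
    ultimately show "AE \<omega> in M. 0 \<le> ?W i \<omega> \<and> ?W i \<omega> \<le> 1"
      using P_UNIV lt AE_space
    proof eventually_elim
      case (elim \<omega>)
      have "0 \<le> P (A i \<inter> - B) \<omega>"
        using P_range[of "A i \<inter> - B" \<omega>] A[of i] Bb elim by simp
      with elim show ?case by simp
    qed
  qed
  have iu: "integrable M ?u"
  proof (rule integrable_const_bound[OF _ uM])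
    show "AE \<omega> in M. norm (?u \<omega>) \<le> 1"
      using AE_space
    proof eventually_elim
      case (elim \<omega>)
      have "0 \<le> P (A i \<inter> B) \<omega> \<and> P (A i \<inter> B) \<omega> \<le> 1" for i
        using P_range[of "A i \<inter> B" \<omega>] A[of i] Bb elim by simp
      then have "0 \<le> (\<Prod>i\<in>S. P (A i \<inter> B) \<omega>)" "(\<Prod>i\<in>S. P (A i \<inter> B) \<omega>) \<le> 1"
        by (auto intro: prod_nonneg prod_le_1)
      moreover have "0 \<le> (1 - P B \<omega>) ^ card ?T" "(1 - P B \<omega>) ^ card ?T \<le> 1"
        using P_range[OF Bb elim] by (auto intro: power_le_one)
      ultimately show ?case
        by (simp add: abs_mult mult_le_one split: split_indicator)
    qed
  qed
  have iv: "integrable M ?v"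
  proof (rule integrable_const_bound[OF _ vM])
    show "AE \<omega> in M. norm (?v \<omega>) \<le> 1"
      using W
    proof eventually_elim
      case (elim \<omega>)
      then have "0 \<le> (\<Prod>i\<in>?T. ?W i \<omega>)" "(\<Prod>i\<in>?T. ?W i \<omega>) \<le> 1"
        by (auto intro!: prod_nonneg prod_le_1)
      then show ?case
        by (simp add: abs_mult del: times_divide_eq_right split: split_indicator)
    qed
  qed
  \<comment> \<open>\<open>sample_rectangle\<close> accepts events generated by \<open>P\<close>, so
    \<open>a\<close> and \<open>b\<close> come from the fields themselves and not from their
    augmentations.\<close>
  have ab: "a \<inter> b \<in> sets (gen_sigma M borel (sets borel) P)" (is "_ \<in> sets ?G")
  proof -
    have G: "P A \<in> borel_measurable ?G" if "A \<in> sets borel" for A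
      using that P_measurable[OF that] by (rule measurable_gen_sigma)
    have "sets ?F \<subseteq> sets ?G"
      unfolding F_sigma_def using indexing_borel by (intro gen_sigma_least G) auto
    moreover have "sets ?H \<subseteq> sets ?G"
      unfolding F_right_def
    proof (rule gen_sigma_least)
      fix D assume "D \<in> {D \<in> finite_unions \<A>. B \<subseteq> D}"
      then have "P D \<in> borel_measurable ?G" "P B \<in> borel_measurable ?G"
        using finite_unions_borel Bb G by auto
      then show "rel_incr P B D \<in> borel_measurable ?G"
        unfolding rel_incr_def[abs_def] by measurable
    qed simp
    ultimately show ?thesis using a b by auto
  qed
  have Ab: "?A i \<in> sets borel" for i
    using A[of i] Bb by simp
  have "?lhs = expectation (\<lambda>\<omega>. indicator (a \<inter> b) \<omega> * (\<Prod>i\<in>{1..n}. P (?A i) \<omega>))"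
    using sample ab Ab by (rule sample_rectangle)
  also have "\<dots> = expectation (\<lambda>\<omega>. ?u \<omega> * ?v \<omega>)"
  proof (rule integral_cong_AE)
    have "a \<in> events" "b \<in> events"
      using a b F H by (auto simp: subalgebra_def)
    then show "(\<lambda>\<omega>. indicator (a \<inter> b) \<omega> * (\<Prod>i\<in>{1..n}. P (?A i) \<omega>)) \<in> borel_measurable M"
      by (intro borel_measurable_times borel_measurable_indicator borel_measurable_prod P_measurable Ab) auto
    show "(\<lambda>\<omega>. ?u \<omega> * ?v \<omega>) \<in> borel_measurable M"
      using uM vM by (rule borel_measurable_times)
    show "AE \<omega> in M. indicator (a \<inter> b) \<omega> * (\<Prod>i\<in>{1..n}. P (?A i) \<omega>) = ?u \<omega> * ?v \<omega>"
      using lt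
    proof eventually_elim
      case (elim \<omega>)
      have "(\<Prod>i\<in>?T. P (A i \<inter> - B) \<omega>) = (\<Prod>i\<in>?T. (1 - P B \<omega>) * ?W i \<omega>)"
        using elim by (intro prod.cong) auto
      also have "\<dots> = (1 - P B \<omega>) ^ card ?T * (\<Prod>i\<in>?T. ?W i \<omega>)"
        unfolding prod.distrib by simp
      finally have T: "(\<Prod>i\<in>?T. P (A i \<inter> - B) \<omega>) = (1 - P B \<omega>) ^ card ?T * (\<Prod>i\<in>?T. ?W i \<omega>)" .
      have "(\<Prod>i\<in>{1..n}. P (?A i) \<omega>) = (\<Prod>i\<in>?T. P (?A i) \<omega>) * (\<Prod>i\<in>S. P (?A i) \<omega>)"
        using S by (intro prod.subset_diff) auto
      also have "(\<Prod>i\<in>S. P (?A i) \<omega>) = (\<Prod>i\<in>S. P (A i \<inter> B) \<omega>)"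
        by (intro prod.cong) auto
      also have "(\<Prod>i\<in>?T. P (?A i) \<omega>) = (\<Prod>i\<in>?T. P (A i \<inter> - B) \<omega>)"
        by (intro prod.cong) auto
      finally show ?case
        unfolding T indicator_inter_arith by (simp only: mult_ac)
    qed
  qed
  also have "\<dots> = expectation ?u * expectation ?v"
    using subalgebra_augment[OF F] subalgebra_augment[OF H]
      indep_set_augment[OF F H F_sigma_indep_F_right[OF B lt]] u v iu iv
    by (rule indep_set_integral_mult)
  finally show ?thesis .
qed

section \<open>Conditional independence given the sample\<close>

lemma sample_measurable:
  "sample_from M P n X \<Longrightarrow> i \<in> {1..n} \<Longrightarrow> X i \<in> measurable M borel"
  unfolding sample_from_def by (elim conjE) (rule bspec)

text \<open>\<open>N1\<close> joins the inner field with the sample points indexed by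
  \<open>S\<close>, and \<open>N2\<close> joins the outer field with the other points. Their
  independence is claimed under the measure conditioned on \<open>E\<close>, since under
  \<open>M\<close> a point indexed by \<open>S\<close> may also fall outside \<open>B\<close>. The
  field of the sample is generated by one part in each of them, as \<open>cond_indep_indep\<close>
  requires.\<close>

lemma sample_cond_indep_on_cell:
  fixes X :: "nat \<Rightarrow> 'w \<Rightarrow> 'x"
  assumes sample: "sample_from M P n X"
    and B: "B \<in> finite_unions \<A>" and lt: "AE \<omega> in M. P B \<omega> < 1" and S: "S \<subseteq> {1..n}"
  defines "E \<equiv> {\<omega>\<in>space M. \<forall>i\<in>{1..n}. X i \<omega> \<in> (if i \<in> S then B else - B)}"
  assumes pos: "prob E > 0"
  shows "cond_indep (uniform_measure M E) (gen_sigma M borel {1..n} X) (F_right B) (F_sigma M \<A> P B)"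
proof -
  let ?T = "{1..n} - S" and ?F = "F_sigma M \<A> P B" and ?H = "F_right B"
  let ?Q = "uniform_measure M E"
  define box where "box K A = {\<omega>\<in>space M. \<forall>i\<in>K. X i \<omega> \<in> A i}" for K and A :: "nat \<Rightarrow> 'x set"
  have Bb: "B \<in> sets borel" using B by (rule finite_unions_borel)
  have box: "box K A \<in> events" if "K \<subseteq> {1..n}" "\<And>i. A i \<in> sets borel" for K A
    unfolding box_def
  proof (rule sets.sets_Collect_finite_All)
    show "finite K" using that(1) by (rule finite_subset) simp
    fix i assume "i \<in> K"
    then have "X i -` A i \<inter> space M \<in> events"
      using that by (intro measurable_sets[OF sample_measurable[OF sample]]) auto
    moreover have "X i -` A i \<inter> space M = {\<omega> \<in> space M. X i \<omega> \<in> A i}" by auto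
    ultimately show "{\<omega> \<in> space M. X i \<omega> \<in> A i} \<in> events" by simp
  qed
  have E_box: "E = box {1..n} (\<lambda>i. if i \<in> S then B else - B)"
    by (simp add: E_def box_def)
  have Eev: "E \<in> events"
    unfolding E_box using Bb by (intro box) auto
  define L where "L K N = {a \<inter> box K A |a A. a \<in> sets N \<and> (\<forall>i. A i \<in> sets borel)}"
    for K and N :: "'w measure"
  have L_box: "a \<inter> box K A \<in> L K N" if "a \<in> sets N" "\<And>i. A i \<in> sets borel" for a K A N
    using that by (auto simp: L_def)
  have box_UNIV: "box K (\<lambda>_. UNIV) = space M" for K
    by (simp add: box_def)
  have F: "subalgebra M ?F" and H: "subalgebra M ?H"
    using subalgebra_F_sigma subalgebra_F_right[OF B] .
  have top: "space M \<in> sets ?F" "space M \<in> sets ?H"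
    using F H sets.top[of ?F] sets.top[of ?H] by (auto simp: subalgebra_def)
  have L_events: "L K N \<subseteq> events" if "subalgebra M N" "K \<subseteq> {1..n}" for K N
    using that box by (auto simp: L_def subalgebra_def)
  have L_stable: "Int_stable (L K N)" for K N
  proof (rule Int_stableI)
    fix s t assume "s \<in> L K N" "t \<in> L K N"
    then obtain a A b A' where st: "s = a \<inter> box K A" "t = b \<inter> box K A'"
      and *: "a \<in> sets N" "b \<in> sets N" "\<And>i. A i \<in> sets borel" "\<And>i. A' i \<in> sets borel"
      unfolding L_def by blast
    have "s \<inter> t = (a \<inter> b) \<inter> box K (\<lambda>i. A i \<inter> A' i)"
      by (auto simp: st box_def)
    with * show "s \<inter> t \<in> L K N" by (auto intro!: L_box)
  qed

  define u where "u a A = expectation (\<lambda>\<omega>. indicator a \<omega> * (\<Prod>i\<in>S. P (A i \<inter> B) \<omega>) *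
    (1 - P B \<omega>) ^ card ?T)" for a and A :: "nat \<Rightarrow> 'x set"
  define v where "v b A = expectation (\<lambda>\<omega>. indicator b \<omega> *
    (\<Prod>i\<in>?T. P (A i \<inter> - B) \<omega> * (1 / (1 - P B \<omega>))))" for b and A :: "nat \<Rightarrow> 'x set"
  have split: "prob (E \<inter> ((a \<inter> box S A) \<inter> (b \<inter> box ?T A'))) = u a A * v b A'"
    if "a \<in> sets ?F" "b \<in> sets ?H" "\<And>i. A i \<in> sets borel" "\<And>i. A' i \<in> sets borel" for a b A A'
  proof -
    \<comment> \<open>\<open>u\<close> depends only on the sets with index in \<open>S\<close> and
      \<open>v\<close> only on the others, so both families can be merged into one.\<close>
    let ?C = "\<lambda>i. if i \<in> S then A i else A' i"
    have "E \<inter> ((a \<inter> box S A) \<inter> (b \<inter> box ?T A')) =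
        a \<inter> b \<inter> {\<omega>\<in>space M. \<forall>i\<in>{1..n}. X i \<omega> \<in> (if i \<in> S then ?C i \<inter> B else ?C i \<inter> - B)}"
      using S by (auto simp: E_def box_def)
    moreover have "u a A = u a ?C" "v b A' = v b ?C"
      unfolding u_def v_def
      by (intro Bochner_Integration.integral_cong refl arg_cong2[where f="(*)"] prod.cong; simp)+
    ultimately show ?thesis
      unfolding u_def v_def
      using sample_rectangle_split[OF sample B lt that(1,2) _ S, of ?C] that(3,4) by simp
  qed
  \<comment> \<open>Each of the four probabilities is a value of \<open>u\<close> times a value of
    \<open>v\<close>, with trivial arguments wherever \<open>s\<close> or \<open>t\<close> is
    absent; both sides then consist of the same four factors.\<close>
  have cross: "prob (E \<inter> (s \<inter> t)) * prob E = prob (E \<inter> s) * prob (E \<inter> t)"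
    if st: "s \<in> L S ?F" "t \<in> L ?T ?H" for s t
  proof -
    obtain a A b A' where s: "s = a \<inter> box S A" "a \<in> sets ?F" "\<And>i. A i \<in> sets borel"
      and t: "t = b \<inter> box ?T A'" "b \<in> sets ?H" "\<And>i. A' i \<in> sets borel"
      using st unfolding L_def by blast
    have sub: "s \<subseteq> space M" "t \<subseteq> space M" "E \<subseteq> space M"
      by (auto simp: s t box_def E_def)
    have "prob (E \<inter> (s \<inter> t)) = u a A * v b A'"
      unfolding s t using s t by (intro split)
    moreover have "prob (E \<inter> s) = u a A * v (space M) (\<lambda>_. UNIV)"
    proof -
      have "E \<inter> s = E \<inter> ((a \<inter> box S A) \<inter> (space M \<inter> box ?T (\<lambda>_. UNIV)))"
        using sub s(1) by (auto simp: box_UNIV)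
      then show ?thesis using split[of a "space M" A "\<lambda>_. UNIV"] s(2,3) top by simp
    qed
    moreover have "prob (E \<inter> t) = u (space M) (\<lambda>_. UNIV) * v b A'"
    proof -
      have "E \<inter> t = E \<inter> ((space M \<inter> box S (\<lambda>_. UNIV)) \<inter> (b \<inter> box ?T A'))"
        using sub t(1) by (auto simp: box_UNIV)
      then show ?thesis using split[of "space M" b "\<lambda>_. UNIV" A'] t(2,3) top by simp
    qed
    moreover have "prob E = u (space M) (\<lambda>_. UNIV) * v (space M) (\<lambda>_. UNIV)"
      using split[of "space M" "space M" "\<lambda>_. UNIV" "\<lambda>_. UNIV"] top sub
      by (simp add: box_UNIV Int_absorb2)
    ultimately show ?thesis by simp
  qed
  define N1 where "N1 = sigma (space M) (L S ?F)"
  define N2 where "N2 = sigma (space M) (L ?T ?H)"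
  have LM: "L S ?F \<subseteq> events" "L ?T ?H \<subseteq> events"
    using L_events[OF F S] L_events[OF H, of ?T] by auto
  have L_Pow: "L S ?F \<subseteq> Pow (space M)" "L ?T ?H \<subseteq> Pow (space M)"
    using LM sets.sets_into_space by blast+
  have N: "sets N1 = sigma_sets (space M) (L S ?F)" "sets N2 = sigma_sets (space M) (L ?T ?H)"
    unfolding N1_def N2_def using L_Pow by simp_all
  have spN: "space N1 = space M" "space N2 = space M"
    by (simp_all add: N1_def N2_def space_measure_of_conv)
  have N_Q: "subalgebra ?Q N1" "subalgebra ?Q N2"
    unfolding subalgebra_def N using LM by (simp_all add: spN sets.sigma_sets_subset)
  have sample_sub: "subalgebra N' (gen_sigma M borel K X)"
    if N': "sets N' = sigma_sets (space M) (L K N)" "space N' = space M" "space M \<in> sets N" for N' K N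
    unfolding subalgebra_def
  proof (intro conjI gen_sigma_least)
    fix i assume i: "i \<in> K"
    show "X i \<in> measurable N' borel"
    proof (rule measurableI)
      fix C :: "'x set" assume C: "C \<in> sets borel"
      have "X i -` C \<inter> space N' = space M \<inter> box K (\<lambda>j. if j = i then C else UNIV)"
        using i by (auto simp: N' box_def)
      also have "\<dots> \<in> L K N"
        using C N' by (intro L_box) auto
      finally show "X i -` C \<inter> space N' \<in> sets N'"
        unfolding N'(1) by (rule sigma_sets.Basic)
    qed simp
  qed (simp_all add: N')
  have G: "subalgebra ?Q (gen_sigma M borel {1..n} X)"
    using subalgebra_gen_sigma[of "{1..n}" X M borel] sample_measurable[OF sample]
    by (simp add: subalgebra_def)
  have "S \<union> ?T = {1..n}" using S by auto
  then have G_eq: "sets (gen_sigma M borel {1..n} X) = sigma_sets (space ?Q)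
      {c \<inter> d |c d. c \<in> sets (gen_sigma M borel S X) \<and> d \<in> sets (gen_sigma M borel ?T X)}"
    using sets_gen_sigma_Un[of M borel S ?T X] by simp
  have Epos: "emeasure M E \<noteq> 0" "emeasure M E \<noteq> \<infinity>"
    using pos by (auto simp: emeasure_eq_measure)
  interpret Q: prob_space ?Q
    using Epos by (rule prob_space_uniform_measure)
  have "Q.indep_set (sets N1) (sets N2)"
    unfolding N using Eev pos LM L_stable L_stable cross by (rule indep_set_uniform_measure)
  then have "cond_indep ?Q (gen_sigma M borel {1..n} X) N2 N1"
    by (rule Q.cond_indep_indep[OF N_Q sample_sub[OF N(1) spN(1) top(1)] sample_sub[OF N(2) spN(2) top(2)]
          G _ G_eq])
  moreover have "sets N \<subseteq> sigma_sets (space M) (L K N)" if N: "subalgebra M N" for K N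
  proof
    fix a assume a: "a \<in> sets N"
    then have "a = a \<inter> box K (\<lambda>_. UNIV)"
      using sets.sets_into_space[OF a] N by (auto simp: box_UNIV subalgebra_def)
    also have "\<dots> \<in> L K N" using a by (rule L_box) simp
    finally show "a \<in> sigma_sets (space M) (L K N)" by (rule sigma_sets.Basic)
  qed
  then have "sets ?F \<subseteq> sets N1" "sets ?H \<subseteq> sets N2"
    unfolding N using F H by blast+
  ultimately show ?thesis
    unfolding cond_indep_def by blast
qed

lemma sample_cond_indep:
  fixes X :: "nat \<Rightarrow> 'w \<Rightarrow> 'x"
  assumes sample: "sample_from M P n X"
    and B: "B \<in> finite_unions \<A>" and lt: "AE \<omega> in M. P B \<omega> < 1"
  shows "cond_indep M (gen_sigma M borel {1..n} X) (F_right B) (F_sigma M \<A> P B)"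
proof -
  let ?G = "gen_sigma M borel {1..n} X"
  let ?E = "\<lambda>S. {\<omega>\<in>space M. \<forall>i\<in>{1..n}. X i \<omega> \<in> (if i \<in> S then B else - B)}"
  have Bb: "B \<in> sets borel" using B by (rule finite_unions_borel)
  show ?thesis
  proof (rule cond_indep_glue)
    show "subalgebra M ?G"
      using sample_measurable[OF sample] by (intro subalgebra_gen_sigma)
    show "subalgebra M (F_right B)" "subalgebra M (F_sigma M \<A> P B)"
      using B by (simp_all add: subalgebra_F_right subalgebra_F_sigma)
    show "finite (?E ` Pow {1..n})" by simp
    show "?E ` Pow {1..n} \<subseteq> sets ?G"
    proof (rule image_subsetI)
      fix S
      have "{\<omega>\<in>space ?G. \<forall>i\<in>{1..n}. X i \<omega> \<in> (if i \<in> S then B else - B)} \<in> sets ?G"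
      proof (rule sets.sets_Collect_finite_All)
        fix i assume "i \<in> {1..n}"
        then have "X i \<in> measurable ?G borel"
          using sample_measurable[OF sample] by (intro measurable_gen_sigma)
        then have "X i -` (if i \<in> S then B else - B) \<inter> space ?G \<in> sets ?G"
          by (rule measurable_sets) (use Bb in simp)
        moreover have "X i -` (if i \<in> S then B else - B) \<inter> space ?G =
            {\<omega>\<in>space ?G. X i \<omega> \<in> (if i \<in> S then B else - B)}" by auto
        ultimately show "{\<omega>\<in>space ?G. X i \<omega> \<in> (if i \<in> S then B else - B)} \<in> sets ?G" by simp
      qed simp
      then show "?E S \<in> sets ?G" by simp
    qed
    show "space M \<subseteq> \<Union>(?E ` Pow {1..n})"
    proof
      fix \<omega> assume "\<omega> \<in> space M"
      \<comment> \<open>The cell containing an outcome is given by the indices of its sample points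
        lying in \<open>B\<close>.\<close>
      then have "\<omega> \<in> ?E {i\<in>{1..n}. X i \<omega> \<in> B}" by simp
      then show "\<omega> \<in> \<Union>(?E ` Pow {1..n})" by (rule UN_I[rotated]) auto
    qed
    fix E assume "E \<in> ?E ` Pow {1..n}" "prob E > 0"
    then obtain S where "S \<subseteq> {1..n}" "E = ?E S" by blast
    with \<open>prob E > 0\<close> show "cond_indep (uniform_measure M E) ?G (F_right B) (F_sigma M \<A> P B)"
      by (simp only:) (rule sample_cond_indep_on_cell[OF sample B lt])
  qed
qed

end

theorem theorem4p8:
  fixes M :: "'w measure" and \<A> :: "'x::t2_space set set"
    and P :: "'x set \<Rightarrow> 'w \<Rightarrow> real" and X :: "nat \<Rightarrow> 'w \<Rightarrow> 'x" and n :: nat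
  assumes "indexing_collection \<A>"
    and "prob_space M"
    and "random_prob_measure M P"
    and "neutral_to_the_right M \<A> P"
    and "1 \<le> n"
    and "sample_from M P n X"
  shows "posterior_neutral_to_the_right M \<A> P n X"
proof -
  interpret prob_space M by fact
  interpret neutral_random_measure M P \<A>
    by unfold_locales fact+
  note sample = \<open>sample_from M P n X\<close>
  let ?G = "gen_sigma M borel {1..n} X"
  have G: "subalgebra M ?G"
    using sample_measurable[OF sample] by (intro subalgebra_gen_sigma)
  show ?thesis
    unfolding posterior_neutral_to_the_right_def
  proof (intro ballI impI)
    fix B1 B2 assume B: "B1 \<in> finite_unions \<A>" "B2 \<in> finite_unions \<A>" "B1 \<subseteq> B2"
    let ?V = "vimage_algebra (space M) (rel_incr P B1 B2) borel"
    have V: "rel_incr P B1 B2 \<in> borel_measurable M"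
      using B by (intro rel_incr_measurable finite_unions_borel)
    from P_eq_1_trivial[OF B(1)] show "cond_indep M ?G ?V (F_sigma M \<A> P B1)"
    proof
      assume lt: "AE \<omega> in M. P B1 \<omega> < 1"
      have "rel_incr P B1 B2 \<in> borel_measurable (F_right B1)"
        unfolding F_right_def using B V by (intro measurable_gen_sigma) simp_all
      moreover have "space (F_right B1) = space M"
        by (simp add: F_right_def)
      ultimately have "sets ?V \<subseteq> sets (F_right B1)"
        by (auto simp: sets_vimage_algebra2 dest: measurable_sets)
      with sample_cond_indep[OF sample B(1) lt] show ?thesis
        unfolding cond_indep_def by blast
    next
      assume "AE \<omega> in M. P B1 \<omega> = 1"
      \<comment> \<open>This is the default value in \<open>rel_incr\<close>.\<close>
      then have "AE \<omega> in M. rel_incr P B1 B2 \<omega> = 1"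
        by eventually_elim (simp add: rel_incr_def)
      then show ?thesis
        using G subalgebra_F_sigma V by (intro cond_indep_AE_const)
    qed
  qed
qed

end
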